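(* Let $\Bbbk$ be a field. For $\varepsilon\in(0,1)$ let $\beta(\varepsilon)$ be the least $\kappa\in[0,1]$ satisfying both $$\varepsilon^2-\kappa(1-\varepsilon)\;\leq\;\frac{(3-\kappa^2)\,\kappa\,\varepsilon}{1+2\kappa-\kappa^2} \qquad\text{and}\qquad 1-\tfrac32(1+\kappa)(1-\varepsilon)\;\leq\;\frac{(3-\kappa^2)\,\kappa\,\varepsilon}{1+2\kappa-\kappa^2}.$$ Then the following hold. (1) Let $\varepsilon\in(0,1)$ and let $(G_j)_{j\ge 1}$ be a sequence of $C_4$-free graphs whose clique complexes are $2$-Leray over $\Bbbk$, whose numbers of vertices $n_j$ tend to infinity, and whose edge densities converge to $\varepsilon$. Then $\liminf_{j\to\infty}\omega(G_j)/n_j\geq\beta(\varepsilon)$. (2) For every $\varepsilon\in(0,1)$, $$\bigl(1-\sqrt{1-\varepsilon}\bigr)^2\;<\;\beta(\varepsilon)\;<\;1-\sqrt{1-\varepsilon}.$$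
   Context: Graphs are finite and simple. A graph is $C_4$-free if it has no induced subgraph isomorphic to the cycle on four vertices. For a graph $G=(V,E)$ on $n$ vertices the edge density is $|E|/\binom{n}{2}$, and the clique number $\omega(G)$ is the order of the largest complete subgraph of $G$. The clique complex $X(G)$ is the simplicial complex on vertex set $V$ whose faces are the cliques of $G$. A simplicial complex $X$ on vertex set $V$ is $2$-Leray over $\Bbbk$ if $\tilde H_p(X[W];\Bbbk)=0$ for all $p\geq 2$ and all $W\subseteq V$, where $X[W]$ is the induced subcomplex on $W$. *)

theory Defs
  imports
    "HOL-Analysis.Analysis"
    "HOL-Algebra.Elementary_Groups"
    "HOL-Library.Ramsey"
begin

type_synonym 'a graph = "'a set \<times> 'a set set"

abbreviation verts :: "'a graph \<Rightarrow> 'a set" where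
  "verts \<equiv> fst"

abbreviation edges :: "'a graph \<Rightarrow> 'a set set" where
  "edges \<equiv> snd"

definition simple_graph :: "'a graph \<Rightarrow> bool" where
  "simple_graph G \<longleftrightarrow> finite (verts G) \<and> edges G \<subseteq> nsets (verts G) 2"

definition induced_subgraph :: "'a graph \<Rightarrow> 'a set \<Rightarrow> 'a graph" where
  "induced_subgraph G W = (W, {e \<in> edges G. e \<subseteq> W})"

definition graph_isomorphic :: "'a graph \<Rightarrow> 'b graph \<Rightarrow> bool" where
  "graph_isomorphic G H \<longleftrightarrow> (\<exists>f. bij_betw f (verts G) (verts H) \<and>
     (\<forall>u\<in>verts G. \<forall>v\<in>verts G. {u, v} \<in> edges G \<longleftrightarrow> {f u, f v} \<in> edges H))"

definition cycle_graph :: "nat \<Rightarrow> nat graph" where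
  "cycle_graph n = ({..<n}, {{i, (i + 1) mod n} | i. i < n})"

definition C4_free :: "'a graph \<Rightarrow> bool" where
  "C4_free G \<longleftrightarrow>
     \<not> (\<exists>W \<subseteq> verts G. graph_isomorphic (induced_subgraph G W) (cycle_graph 4))"

definition edge_density :: "'a graph \<Rightarrow> real" where
  "edge_density G = real (card (edges G)) / real (card (verts G) choose 2)"

definition clique_complex :: "'a graph \<Rightarrow> 'a set set" where
  "clique_complex G = {K. K \<subseteq> verts G \<and> clique K (edges G)}"

definition clique_number :: "'a graph \<Rightarrow> nat" where
  "clique_number G = Max {card K | K. K \<subseteq> verts G \<and> clique K (edges G)}"

text \<open>A finite simplicial complex is given by its set of faces, the empty face included.
  Faces are oriented by the linear order of the vertex type; up to isomorphism the homology
  does not depend on that order.\<close>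

definition faces :: "nat \<Rightarrow> 'a set set \<Rightarrow> 'a set set" where
  "faces p X = {\<sigma> \<in> X. finite \<sigma> \<and> card \<sigma> = p + 1}"

definition chain_group :: "nat \<Rightarrow> 'a set set \<Rightarrow> ('a set \<Rightarrow> 'k::field) monoid" where
  "chain_group p X =
     \<lparr>carrier = {c. \<forall>\<sigma>. \<sigma> \<notin> faces p X \<longrightarrow> c \<sigma> = 0},
      mult = (\<lambda>c d \<sigma>. c \<sigma> + d \<sigma>), one = (\<lambda>\<sigma>. 0)\<rparr>"

text \<open>The linear extension of
  \<open>[v\<^sub>0, \<dots>, v\<^sub>p] \<mapsto> (\<Sum>i\<le>p. (-1)^i [v\<^sub>0, \<dots>, v\<^sub>i\<^sub>-\<^sub>1, v\<^sub>i\<^sub>+\<^sub>1, \<dots>, v\<^sub>p])\<close> for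
  \<open>v\<^sub>0 < \<dots> < v\<^sub>p\<close>. For \<open>p = 0\<close> it takes values in the chains on the
  empty face, so it is the augmentation and the homology below is reduced.\<close>

definition boundary ::
    "nat \<Rightarrow> 'a::linorder set set \<Rightarrow> ('a set \<Rightarrow> 'k::field) \<Rightarrow> 'a set \<Rightarrow> 'k" where
  "boundary p X c = (\<lambda>\<tau>. \<Sum>\<sigma>\<in>faces p X. \<Sum>i\<le>p.
     if \<tau> = \<sigma> - {sorted_list_of_set \<sigma> ! i} then (-1) ^ i * c \<sigma> else 0)"

definition cycles :: "nat \<Rightarrow> 'a::linorder set set \<Rightarrow> ('a set \<Rightarrow> 'k::field) set" where
  "cycles p X = {c \<in> carrier (chain_group p X). boundary p X c = (\<lambda>\<tau>. 0)}"

definition boundaries :: "nat \<Rightarrow> 'a::linorder set set \<Rightarrow> ('a set \<Rightarrow> 'k::field) set" where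
  "boundaries p X = boundary (p + 1) X ` carrier (chain_group (p + 1) X)"

definition reduced_homology ::
    "nat \<Rightarrow> 'a::linorder set set \<Rightarrow> ('a set \<Rightarrow> 'k::field) set monoid" where
  "reduced_homology p X = (chain_group p X)\<lparr>carrier := cycles p X\<rparr> Mod boundaries p X"

definition induced_subcomplex :: "'a set set \<Rightarrow> 'a set \<Rightarrow> 'a set set" where
  "induced_subcomplex X W = {\<sigma> \<in> X. \<sigma> \<subseteq> W}"

definition leray ::
    "'k::field itself \<Rightarrow> nat \<Rightarrow> 'a::linorder set \<Rightarrow> 'a set set \<Rightarrow> bool" where
  "leray K d V X \<longleftrightarrow> (\<forall>p\<ge>d. \<forall>W\<subseteq>V.
     trivial_group (reduced_homology p (induced_subcomplex X W) :: ('a set \<Rightarrow> 'k) set monoid))"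

definition beta_admissible :: "real \<Rightarrow> real \<Rightarrow> bool" where
  "beta_admissible \<epsilon> \<kappa> \<longleftrightarrow> 0 \<le> \<kappa> \<and> \<kappa> \<le> 1 \<and>
     \<epsilon>^2 - \<kappa> * (1 - \<epsilon>) \<le> (3 - \<kappa>^2) * \<kappa> * \<epsilon> / (1 + 2 * \<kappa> - \<kappa>^2) \<and>
     1 - 3 / 2 * (1 + \<kappa>) * (1 - \<epsilon>) \<le> (3 - \<kappa>^2) * \<kappa> * \<epsilon> / (1 + 2 * \<kappa> - \<kappa>^2)"

definition beta :: "real \<Rightarrow> real" where
  "beta \<epsilon> = (LEAST \<kappa>. beta_admissible \<epsilon> \<kappa>)"

lemma beta_least:
  assumes "0 < \<epsilon>" "\<epsilon> < 1"
  shows "beta_admissible \<epsilon> (beta \<epsilon>)" "\<And>\<kappa>. beta_admissible \<epsilon> \<kappa> \<Longrightarrow> beta \<epsilon> \<le> \<kappa>"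
proof -
  let ?S = "{\<kappa>. beta_admissible \<epsilon> \<kappa>}"
  let ?r = "\<lambda>\<kappa>. (3 - \<kappa>^2) * \<kappa> * \<epsilon> / (1 + 2 * \<kappa> - \<kappa>^2)"
  have ne: "1 + 2 * \<kappa> - \<kappa>^2 \<noteq> 0" if "\<kappa> \<in> {0..1}" for \<kappa> :: real
  proof -
    have "\<kappa> * \<kappa> \<le> \<kappa>" using that by (simp add: mult_left_le)
    then have "1 + 2 * \<kappa> - \<kappa> * \<kappa> > 0" using that by simp
    then show ?thesis by (simp add: power2_eq_square)
  qed
  have S: "?S = {\<kappa> \<in> {0..1}. \<epsilon>^2 - \<kappa> * (1 - \<epsilon>) \<le> ?r \<kappa>} \<inter>
      {\<kappa> \<in> {0..1}. 1 - 3 / 2 * (1 + \<kappa>) * (1 - \<epsilon>) \<le> ?r \<kappa>}"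
    by (auto simp: beta_admissible_def)
  have "closed ?S"
    unfolding S
    by (intro closed_Int continuous_on_closed_Collect_le continuous_intros ballI closed_atLeastAtMost)
       (use ne in auto)
  moreover have "bounded ?S"
    by (rule bounded_subset[of "{0..1}"]) (auto simp: beta_admissible_def)
  moreover have "1 \<in> ?S"
    using assms power_le_one[of \<epsilon> 2] mult_left_le[of \<epsilon> \<epsilon>]
    by (simp add: beta_admissible_def power2_eq_square) (simp add: field_simps)
  ultimately have "compact ?S" "?S \<noteq> {}"
    unfolding compact_eq_bounded_closed by blast+
  from compact_attains_inf[OF this]
  obtain m where m: "beta_admissible \<epsilon> m" "\<And>\<kappa>. beta_admissible \<epsilon> \<kappa> \<Longrightarrow> m \<le> \<kappa>"
    by blast
  have "beta \<epsilon> = m"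
    unfolding beta_def by (rule Least_equality[of "beta_admissible \<epsilon>", OF m])
  with m show "beta_admissible \<epsilon> (beta \<epsilon>)"
    "\<And>\<kappa>. beta_admissible \<epsilon> \<kappa> \<Longrightarrow> beta \<epsilon> \<le> \<kappa>"
    by simp_all
qed

end

theory Submission
  imports Defs "HOL-Library.Poly_Mapping"
begin

text \<open>Let a graph have \<open>n\<close> vertices, \<open>t\<close> triangles and clique number \<open>r\<close>. The heart of the matter is
  the asymptotic inequality \<open>\<tau> \<le> c(\<kappa>) \<epsilon>\<close> between
  the triangle density, the edge density and \<open>\<kappa> = r / n\<close>, where
  \<open>c(\<kappa>) = (3 - \<kappa>\<^sup>2) \<kappa> / (1 + 2 \<kappa> - \<kappa>\<^sup>2)\<close>. In a \<open>C\<^sub>4\<close>-free graph non-adjacent vertices have at most \<open>r\<close>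
  common neighbours; counting induced paths on three vertices this gives two lower bounds for
  \<open>\<tau>\<close>, which are the left-hand sides in the definition of \<open>\<beta>\<close>.

  For the inequality, let the chains of the clique complex have polynomial coefficients and
  consider boundary operators \<open>d\<^sub>0, d\<^sub>1, \<dots>\<close> weighted by independent families of indeterminates.
  The multigraded pieces of the chain complex with respect to \<open>d\<^sub>i\<close> are the chain complexes of the
  induced subcomplexes, so the 2-Leray property makes each \<open>d\<^sub>i\<close> exact in dimensions at least 2,
  and a zigzag argument extends this to the common kernels of several \<open>d\<^sub>i\<close>. Hence a
  2-chain killed by \<open>d\<^sub>0, \<dots>, d\<^sub>r\<^sub>-\<^sub>1\<close> vanishes when there is no clique on \<open>r + 3\<close> vertices.
  Counting the linear equations that force a 2-chain into this kernel yields, for every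
  order of the vertices, \<open>t \<le> \<Sum>\<^sub>v \<Sum>\<^sub>s\<^sub><\<^sub>r max 0 (d(v) - s - 1)\<close> with \<open>d(v)\<close> the number of
  neighbours preceding \<open>v\<close>.

  By \<open>C\<^sub>4\<close>-freeness the vertices with fewer than \<open>(n - r) / 2\<close> non-neighbours form a clique. Put
  them first and order the remaining vertices at random: the expected value of the right-hand
  side is then bounded vertex by vertex.\<close>

section \<open>Boundary operators with indeterminate weights\<close>

text \<open>Monomials in the indeterminates \<open>x\<^sub>i\<^sub>,\<^sub>v\<close>, \<open>v\<close> a vertex: exponents are stored as \<open>v \<mapsto> (i \<mapsto> e)\<close>
  because polynomials form an \<open>idom\<close> only over a linearly ordered type of monomials and the product
  of the index types carries no linear order here.\<close>

type_synonym 'a monomial = "'a \<Rightarrow>\<^sub>0 (nat \<Rightarrow>\<^sub>0 nat)"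
type_synonym ('a, 'k) indet_poly = "'a monomial \<Rightarrow>\<^sub>0 'k"

definition indet_mon :: "nat \<Rightarrow> 'a \<Rightarrow> 'a monomial" where
  "indet_mon i v = Poly_Mapping.single v (Poly_Mapping.single i 1)"

definition expo :: "'a monomial \<Rightarrow> nat \<Rightarrow> 'a \<Rightarrow> nat" where
  "expo M i v = Poly_Mapping.lookup (Poly_Mapping.lookup M v) i"

definition indet :: "nat \<Rightarrow> 'a \<Rightarrow> ('a, 'k::comm_ring_1) indet_poly" where
  "indet i v = Poly_Mapping.single (indet_mon i v) 1"

lemma expo_add [simp]: "expo (M + N) i v = expo M i v + expo N i v"
  by (simp add: expo_def lookup_add)

lemma expo_minus [simp]: "expo (M - N) i v = expo M i v - expo N i v"
  by (simp add: expo_def lookup_minus)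

lemma expo_zero [simp]: "expo 0 i v = 0"
  by (simp add: expo_def)

lemma expo_indet_mon: "expo (indet_mon j w) i v = (if i = j \<and> v = w then 1 else 0)"
  by (auto simp: expo_def indet_mon_def lookup_single when_def)

lemma monomial_eqI:
  assumes "\<And>i v. expo M i v = expo N i v" shows "M = N"
  using assms unfolding expo_def by (intro poly_mapping_eqI) auto

lemma indet_mon_minus_add:
  assumes "expo M i v \<ge> 1" shows "M - indet_mon i v + indet_mon i v = M"
  using assms by (intro monomial_eqI) (auto simp: expo_indet_mon)

lemma lookup_single_mult:
  fixes q :: "'m::cancel_comm_monoid_add \<Rightarrow>\<^sub>0 'k::comm_ring_1"
  shows "Poly_Mapping.lookup (Poly_Mapping.single a 1 * q) k
    = (if \<exists>b. k = a + b then Poly_Mapping.lookup q (k - a) else 0)"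
proof -
  have *: "Poly_Mapping.lookup (Poly_Mapping.single a 1 * q) k
      = (\<Sum>l. Poly_Mapping.lookup q l when k = a + l)"
    by (simp add: lookup_mult lookup_single when_mult)
  show ?thesis
  proof (cases "\<exists>b. k = a + b")
    case True
    then obtain b where b: "k = a + b" by blast
    show ?thesis unfolding * by (simp add: b)
  qed (simp add: *)
qed

lemma lookup_indet_mult:
  "Poly_Mapping.lookup (indet i v * q) M
    = (if expo M i v \<ge> 1 then Poly_Mapping.lookup q (M - indet_mon i v) else 0)"
proof -
  have "(\<exists>b. M = indet_mon i v + b) \<longleftrightarrow> expo M i v \<ge> 1"
    using indet_mon_minus_add[of M i v] by (metis add.commute le_add1 expo_add expo_indet_mon)
  then show ?thesis by (simp add: indet_def lookup_single_mult)
qed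

text \<open>Counting the smaller vertices gives the position of \<open>v\<close> in the sorted list
  of \<open>insert v \<tau>\<close>, so no lists enter the computations with signs.\<close>

definition face_sign :: "'a::linorder set \<Rightarrow> 'a \<Rightarrow> 'r::comm_ring_1" where
  "face_sign \<tau> v = (-1) ^ card {u \<in> \<tau>. u < v}"

text \<open>Of the two orders of insertion, exactly the one that inserts the smaller of
  \<open>v\<close> and \<open>w\<close> first puts one more vertex below the other.\<close>

lemma face_sign_swap:
  assumes "finite \<tau>" "v \<notin> \<tau>" "w \<notin> \<tau>" "v \<noteq> w"
  shows "face_sign \<tau> v * face_sign (insert v \<tau>) w = - (face_sign \<tau> w * face_sign (insert w \<tau>) v :: 'r::comm_ring_1)"
proof -
  have ins: "card {u \<in> insert a \<tau>. u < b} = card {u \<in> \<tau>. u < b} + (if a < b then 1 else 0)"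
    if "a \<notin> \<tau>" for a b
  proof -
    have "{u \<in> insert a \<tau>. u < b} = (if a < b then insert a {u \<in> \<tau>. u < b} else {u \<in> \<tau>. u < b})"
      by auto
    then show ?thesis using that assms(1) by simp
  qed
  show ?thesis
    unfolding face_sign_def ins[OF assms(2)] ins[OF assms(3)] using assms(4)
    by (cases v w rule: linorder_cases) (auto simp: power_add)
qed

lemma lookup_face_sign_mult:
  "Poly_Mapping.lookup (face_sign \<tau> v * (q :: 'm::comm_monoid_add \<Rightarrow>\<^sub>0 'k::comm_ring_1)) M = face_sign \<tau> v * Poly_Mapping.lookup q M"
  by (cases "even (card {u \<in> \<tau>. u < v})") (auto simp: face_sign_def)

lemma face_sign_neq_0 [simp]: "face_sign \<tau> v \<noteq> (0 :: 'r::idom)"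
  by (simp add: face_sign_def)

text \<open>The operator \<open>d\<^sub>i\<close> of the introduction: removing \<open>v\<close> is weighted by \<open>x\<^sub>i\<^sub>,\<^sub>v\<close>. The value \<open>0\<close> off the
  subsets of \<open>V\<close> lets the identities below hold without any assumption on \<open>z\<close>.\<close>

definition wboundary ::
    "'a::linorder set \<Rightarrow> nat \<Rightarrow> ('a set \<Rightarrow> ('a, 'k::comm_ring_1) indet_poly) \<Rightarrow> 'a set \<Rightarrow> ('a, 'k) indet_poly" where
  "wboundary V i z \<tau> = (if \<tau> \<subseteq> V then \<Sum>v\<in>V - \<tau>. face_sign \<tau> v * (indet i v * z (insert v \<tau>)) else 0)"

lemma wboundary_zero [simp]: "wboundary V i (\<lambda>\<sigma>. 0) = (\<lambda>\<sigma>. 0)"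
  by (simp add: wboundary_def fun_eq_iff)

lemma wboundary_add: "wboundary V i (\<lambda>\<sigma>. z \<sigma> + w \<sigma>) = (\<lambda>\<tau>. wboundary V i z \<tau> + wboundary V i w \<tau>)"
  by (auto simp: wboundary_def fun_eq_iff algebra_simps sum.distrib)

text \<open>Summing over ordered pairs lets the swap of coordinates act on the index set, which is
  how both identities below are proved.\<close>

lemma wboundary_wboundary:
  assumes "finite V" "\<tau> \<subseteq> V"
  shows "wboundary V i (wboundary V j z) \<tau> = (\<Sum>(v, w) \<in> Sigma (V - \<tau>) (\<lambda>v. V - insert v \<tau>).
    face_sign \<tau> v * face_sign (insert v \<tau>) w * (indet i v * indet j w * z (insert v (insert w \<tau>))))"
proof -
  have "wboundary V i (wboundary V j z) \<tau> = (\<Sum>v\<in>V - \<tau>. \<Sum>w\<in>V - insert v \<tau>.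
    face_sign \<tau> v * face_sign (insert v \<tau>) w * (indet i v * indet j w * z (insert v (insert w \<tau>))))"
    using assms by (simp add: wboundary_def sum_distrib_left mult.assoc mult.left_commute insert_commute)
  also have "\<dots> = (\<Sum>(v, w) \<in> Sigma (V - \<tau>) (\<lambda>v. V - insert v \<tau>).
    face_sign \<tau> v * face_sign (insert v \<tau>) w * (indet i v * indet j w * z (insert v (insert w \<tau>))))"
    using assms by (intro sum.Sigma) auto
  finally show ?thesis .
qed

lemma mult_swap_uminus: "p = - q \<Longrightarrow> p * (x * y * c) = - (q * (y * x * c) :: 'r::comm_ring_1)"
  by (simp add: algebra_simps)

lemma wboundary_anticommute:
  assumes "finite V"
  shows "wboundary V i (wboundary V j z) = (\<lambda>\<tau>. - wboundary V j (wboundary V i z) \<tau>)"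
proof
  fix \<tau>
  show "wboundary V i (wboundary V j z) \<tau> = - wboundary V j (wboundary V i z) \<tau>"
  proof (cases "\<tau> \<subseteq> V")
    case True
    let ?S = "Sigma (V - \<tau>) (\<lambda>v. V - insert v \<tau>)"
    have fin: "finite \<tau>" using assms True finite_subset by blast
    have "wboundary V i (wboundary V j z) \<tau> = (\<Sum>(v, w) \<in> ?S.
      face_sign \<tau> w * face_sign (insert w \<tau>) v * (indet i w * indet j v * z (insert w (insert v \<tau>))))"
      unfolding wboundary_wboundary[OF assms True]
      by (rule sum.reindex_bij_witness[where i = prod.swap and j = prod.swap]) auto
    also have "\<dots> = (\<Sum>(v, w) \<in> ?S.
      - (face_sign \<tau> v * face_sign (insert v \<tau>) w * (indet j v * indet i w * z (insert v (insert w \<tau>)))))"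
    proof (intro sum.cong refl)
      fix x assume "x \<in> ?S"
      then obtain v w where x: "x = (v, w)" "v \<notin> \<tau>" "w \<notin> \<tau>" "v \<noteq> w" by auto
      then have "face_sign \<tau> w * face_sign (insert w \<tau>) v = - (face_sign \<tau> v * face_sign (insert v \<tau>) w :: ('a, 'b) indet_poly)"
        using fin by (intro face_sign_swap) auto
      then show "(case x of (v, w) \<Rightarrow> face_sign \<tau> w * face_sign (insert w \<tau>) v * (indet i w * indet j v * z (insert w (insert v \<tau>))))
        = (case x of (v, w) \<Rightarrow> - (face_sign \<tau> v * face_sign (insert v \<tau>) w * (indet j v * indet i w * z (insert v (insert w \<tau>)))))"
        by (simp add: x(1) insert_commute mult_swap_uminus)
    qed
    also have "\<dots> = - wboundary V j (wboundary V i z) \<tau>"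
      unfolding wboundary_wboundary[OF assms True] by (simp add: sum_negf case_prod_unfold)
    finally show ?thesis .
  qed (simp add: wboundary_def)
qed

lemma mult_swap_cancel: "p = - q \<Longrightarrow> q * (x * y * c) + p * (y * x * c) = (0 :: 'r::comm_ring_1)"
  by (simp add: algebra_simps)

text \<open>Anticommutation alone does not give this in characteristic 2.\<close>

lemma wboundary_wboundary_same:
  assumes "finite V"
  shows "wboundary V i (wboundary V i z) = (\<lambda>\<tau>. 0)"
proof
  fix \<tau>
  show "wboundary V i (wboundary V i z) \<tau> = 0"
  proof (cases "\<tau> \<subseteq> V")
    case True
    let ?S = "Sigma (V - \<tau>) (\<lambda>v. V - insert v \<tau>)"
    let ?f = "\<lambda>(v, w). face_sign \<tau> v * face_sign (insert v \<tau>) w * (indet i v * indet i w * z (insert v (insert w \<tau>)))"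
    let ?A = "{(v, w) \<in> ?S. v < w}"
    have fin: "finite \<tau>" using assms True finite_subset by blast
    have finS: "finite ?S" using assms by auto
    have S: "?S = ?A \<union> prod.swap ` ?A" by (auto simp: image_iff)
    have finA: "finite ?A" using finS by (rule finite_subset[rotated]) auto
    have "sum ?f ?S = sum ?f (?A \<union> prod.swap ` ?A)"
      by (rule arg_cong[OF S])
    also have "\<dots> = sum ?f ?A + sum ?f (prod.swap ` ?A)"
      using finA by (intro sum.union_disjoint) auto
    also have "sum ?f (prod.swap ` ?A) = sum (?f \<circ> prod.swap) ?A"
      by (rule sum.reindex) (auto simp: inj_on_def)
    also have "sum ?f ?A + sum (?f \<circ> prod.swap) ?A = 0"
      unfolding sum.distrib[symmetric]
    proof (intro sum.neutral ballI)
      fix x assume "x \<in> ?A"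
      then obtain v w where x: "x = (v, w)" "v \<notin> \<tau>" "w \<notin> \<tau>" "v \<noteq> w" by auto
      then have "face_sign \<tau> w * face_sign (insert w \<tau>) v = - (face_sign \<tau> v * face_sign (insert v \<tau>) w :: ('a, 'b) indet_poly)"
        using fin by (intro face_sign_swap) auto
      then show "?f x + (?f \<circ> prod.swap) x = 0"
        by (simp add: x(1) insert_commute mult_swap_cancel)
    qed
    finally show ?thesis
      unfolding wboundary_wboundary[OF assms True] .
  qed (simp add: wboundary_def)
qed

section \<open>Comparison with the simplicial boundary and its homology\<close>

lemma card_less_nth:
  assumes "finite (\<sigma> :: 'a::linorder set)" "i < card \<sigma>"
  shows "card {u \<in> \<sigma>. u < sorted_list_of_set \<sigma> ! i} = i"
proof -
  let ?l = "sorted_list_of_set \<sigma>"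
  have len: "length ?l = card \<sigma>" and ss: "sorted_wrt (<) ?l" and st: "set ?l = \<sigma>"
    using assms(1) by auto
  have "{u \<in> \<sigma>. u < ?l ! i} = (!) ?l ` {..<i}"
  proof (intro subset_antisym subsetI)
    fix u assume "u \<in> {u \<in> \<sigma>. u < ?l ! i}"
    then obtain j where j: "j < card \<sigma>" "u = ?l ! j" "?l ! j < ?l ! i"
      using st len by (metis (no_types, lifting) in_set_conv_nth mem_Collect_eq)
    have "j < i"
      using j ss len assms(2) by (metis linorder_neqE_nat not_less_iff_gr_or_eq sorted_wrt_iff_nth_less)
    then show "u \<in> (!) ?l ` {..<i}" using j by auto
  next
    fix u assume "u \<in> (!) ?l ` {..<i}"
    then obtain j where j: "j < i" "u = ?l ! j" by auto
    then have "u \<in> set ?l" using len assms(2) by simp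
    then show "u \<in> {u \<in> \<sigma>. u < ?l ! i}"
      using j ss len assms(2) st sorted_wrt_nth_less[OF ss j(1)] by auto
  qed
  moreover have "inj_on ((!) ?l) {..<i}"
    using len assms(2) by (intro inj_on_nth) auto
  ultimately show ?thesis by (simp add: card_image)
qed

text \<open>Brings \<open>boundary\<close> into the shape of \<open>wboundary\<close>: after the
  order of summation is exchanged, the only face that yields \<open>\<tau>\<close> by losing
  \<open>v\<close> is \<open>insert v \<tau>\<close>, and by \<open>card_less_nth\<close> the
  position of \<open>v\<close> gives \<open>face_sign\<close>.\<close>

lemma boundary_eq:
  fixes c :: "'a::linorder set \<Rightarrow> 'k::field"
  assumes "finite W" "\<tau> \<subseteq> W"
    and c: "\<And>\<sigma>. c \<sigma> \<noteq> 0 \<Longrightarrow> \<sigma> \<in> faces p Y" and W: "\<And>\<sigma>. \<sigma> \<in> faces p Y \<Longrightarrow> \<sigma> \<subseteq> W"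
  shows "boundary p Y c \<tau> = (\<Sum>v\<in>W - \<tau>. face_sign \<tau> v * c (insert v \<tau>))"
proof -
  let ?F = "faces p Y"
  have finF: "finite ?F"
    using W assms(1) by (meson Pow_iff finite_Pow_iff finite_subset subsetI)
  have inner: "(\<Sum>i\<le>p. if \<tau> = \<sigma> - {sorted_list_of_set \<sigma> ! i} then (-1) ^ i * c \<sigma> else 0)
      = (\<Sum>v\<in>W. if v \<in> \<sigma> \<and> \<tau> = \<sigma> - {v} then face_sign \<tau> v * c \<sigma> else 0)" if \<sigma>: "\<sigma> \<in> ?F" for \<sigma>
  proof -
    let ?l = "sorted_list_of_set \<sigma>"
    have fin: "finite \<sigma>" "card \<sigma> = Suc p" using \<sigma> by (auto simp: faces_def)
    have bij: "bij_betw ((!) ?l) {..p} \<sigma>"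
      using bij_betw_nth[of ?l "{..<length ?l}" \<sigma>] fin by (simp add: lessThan_Suc_atMost)
    have "(\<Sum>i\<le>p. if \<tau> = \<sigma> - {?l ! i} then (-1) ^ i * c \<sigma> else 0)
        = (\<Sum>i\<le>p. if \<tau> = \<sigma> - {?l ! i} then face_sign \<tau> (?l ! i) * c \<sigma> else 0)"
    proof (intro sum.cong refl if_cong)
      fix i assume i: "i \<in> {..p}" "\<tau> = \<sigma> - {?l ! i}"
      have "{u \<in> \<tau>. u < ?l ! i} = {u \<in> \<sigma>. u < ?l ! i}" using i by auto
      then show "(-1) ^ i * c \<sigma> = face_sign \<tau> (?l ! i) * c \<sigma>"
        using card_less_nth[OF fin(1), of i] fin(2) i(1) by (simp add: face_sign_def)
    qed
    also have "\<dots> = (\<Sum>v\<in>\<sigma>. if \<tau> = \<sigma> - {v} then face_sign \<tau> v * c \<sigma> else 0)"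
      by (rule sum.reindex_bij_betw[OF bij])
    also have "\<dots> = (\<Sum>v\<in>W. if v \<in> \<sigma> \<and> \<tau> = \<sigma> - {v} then face_sign \<tau> v * c \<sigma> else 0)"
      using W[OF \<sigma>] assms(1) by (intro sum.mono_neutral_cong_left) auto
    finally show ?thesis .
  qed
  have "boundary p Y c \<tau> = (\<Sum>\<sigma>\<in>?F. \<Sum>v\<in>W. if v \<in> \<sigma> \<and> \<tau> = \<sigma> - {v} then face_sign \<tau> v * c \<sigma> else 0)"
    unfolding boundary_def by (intro sum.cong refl inner)
  also have "\<dots> = (\<Sum>v\<in>W. \<Sum>\<sigma>\<in>?F. if v \<in> \<sigma> \<and> \<tau> = \<sigma> - {v} then face_sign \<tau> v * c \<sigma> else 0)"
    by (rule sum.swap)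
  also have "\<dots> = (\<Sum>v\<in>W. if v \<notin> \<tau> then face_sign \<tau> v * c (insert v \<tau>) else 0)"
  proof (intro sum.cong refl)
    fix v assume "v \<in> W"
    have "(\<Sum>\<sigma>\<in>?F. if v \<in> \<sigma> \<and> \<tau> = \<sigma> - {v} then face_sign \<tau> v * c \<sigma> else 0)
        = (\<Sum>\<sigma>\<in>?F. if \<sigma> = insert v \<tau> then (if v \<notin> \<tau> then face_sign \<tau> v * c (insert v \<tau>) else 0) else 0)"
      by (intro sum.cong refl) auto
    also have "\<dots> = (if v \<notin> \<tau> then face_sign \<tau> v * c (insert v \<tau>) else 0)"
      using c[of "insert v \<tau>"] finF by (auto simp: sum.delta)
    finally show "(\<Sum>\<sigma>\<in>?F. if v \<in> \<sigma> \<and> \<tau> = \<sigma> - {v} then face_sign \<tau> v * c \<sigma> else 0)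
        = (if v \<notin> \<tau> then face_sign \<tau> v * c (insert v \<tau>) else 0)" .
  qed
  also have "\<dots> = (\<Sum>v\<in>W - \<tau>. face_sign \<tau> v * c (insert v \<tau>))"
    using assms(1) by (intro sum.mono_neutral_cong_right) auto
  finally show ?thesis .
qed

text \<open>In a trivial quotient the coset of the cycle is the set of boundaries itself, and this
  coset contains the cycle because 0 is a boundary.\<close>

lemma leray_exact:
  fixes c :: "'a::linorder set \<Rightarrow> 'k::field"
  assumes "leray TYPE('k) d V X" "p \<ge> d" "W \<subseteq> V"
    and c: "c \<in> cycles p (induced_subcomplex X W)"
  obtains e where "e \<in> carrier (chain_group (p + 1) (induced_subcomplex X W))"
    "boundary (p + 1) (induced_subcomplex X W) e = c"
proof -
  let ?Y = "induced_subcomplex X W"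
  let ?G = "(chain_group p ?Y)\<lparr>carrier := cycles p ?Y\<rparr> :: ('a set \<Rightarrow> 'k) monoid"
  have "trivial_group (?G Mod boundaries p ?Y)"
    using assms unfolding leray_def reduced_homology_def by blast
  then have "carrier (?G Mod boundaries p ?Y) = {boundaries p ?Y}"
    by (simp add: trivial_group_def FactGroup_def)
  moreover have "boundaries p ?Y #>\<^bsub>?G\<^esub> c \<in> carrier (?G Mod boundaries p ?Y)"
    using c by (auto simp: FactGroup_def RCOSETS_def)
  ultimately have eq: "boundaries p ?Y #>\<^bsub>?G\<^esub> c = boundaries p ?Y" by simp
  have "(\<lambda>\<sigma>. 0) \<in> boundaries p ?Y"
    unfolding boundaries_def
    by (rule image_eqI[of _ _ "\<lambda>\<sigma>. 0"]) (auto simp: boundary_def chain_group_def fun_eq_iff cong: if_cong)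
  then have "c \<in> boundaries p ?Y #>\<^bsub>?G\<^esub> c"
    by (auto simp: r_coset_def chain_group_def intro!: bexI[of _ "\<lambda>\<sigma>. 0"])
  then show ?thesis
    using that eq unfolding boundaries_def by auto
qed

section \<open>Exactness of the weighted boundary\<close>

definition face_mon :: "nat \<Rightarrow> 'a set \<Rightarrow> 'a monomial" where
  "face_mon j \<sigma> = (\<Sum>v\<in>\<sigma>. indet_mon j v)"

lemma expo_sum: "expo (sum f A) i v = (\<Sum>a\<in>A. expo (f a) i v)"
  by (simp add: expo_def lookup_sum)

lemma expo_face_mon: "finite \<sigma> \<Longrightarrow> expo (face_mon j \<sigma>) i v = (if i = j \<and> v \<in> \<sigma> then 1 else 0)"
  by (auto simp: face_mon_def expo_sum expo_indet_mon)

locale two_leray =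
  fixes V :: "'a::linorder set" and X :: "'a set set" and field_type :: "'k::field itself"
  assumes finV: "finite V"
    and face_sub: "\<And>\<sigma>. \<sigma> \<in> X \<Longrightarrow> \<sigma> \<subseteq> V"
    and face_closed: "\<And>\<sigma> \<tau>. \<sigma> \<in> X \<Longrightarrow> \<tau> \<subseteq> \<sigma> \<Longrightarrow> \<tau> \<in> X"
    and leray2: "leray TYPE('k) 2 V X"
begin

definition poly_chain :: "nat \<Rightarrow> ('a set \<Rightarrow> ('a, 'k) indet_poly) \<Rightarrow> bool" where
  "poly_chain p z \<longleftrightarrow> (\<forall>\<sigma>. z \<sigma> \<noteq> 0 \<longrightarrow> \<sigma> \<in> faces p X)"

text \<open>The measure on which the zigzag between several operators terminates.\<close>

definition group_degree :: "nat \<Rightarrow> 'a monomial \<Rightarrow> nat" where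
  "group_degree l M = (\<Sum>v\<in>V. expo M l v)"

lemma finite_faces: "finite (faces p X)"
  using face_sub finV by (intro finite_subset[of "faces p X" "Pow V"]) (auto simp: faces_def)

lemma facesD: "\<sigma> \<in> faces p X \<Longrightarrow> finite \<sigma> \<and> card \<sigma> = p + 1 \<and> \<sigma> \<subseteq> V \<and> \<sigma> \<in> X"
  using face_sub by (auto simp: faces_def)

lemma group_degree_add: "group_degree l (M + N) = group_degree l M + group_degree l N"
  by (simp add: group_degree_def sum.distrib)

lemma group_degree_face_mon: "\<sigma> \<subseteq> V \<Longrightarrow> group_degree l (face_mon j \<sigma>) = (if l = j then card \<sigma> else 0)"
  using finV finite_subset[of \<sigma> V]
  by (auto simp: group_degree_def expo_face_mon Int_absorb1 sum.If_cases)

text \<open>The part of multidegree \<open>U\<close> of \<open>z\<close>, where a face \<open>\<sigma>\<close> is given the degree of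
  \<open>\<Prod>\<^sub>v\<^sub>\<in>\<^sub>\<sigma> x\<^sub>j\<^sub>,\<^sub>v\<close>, is an ordinary cycle of the subcomplex induced on the vertices whose
  indeterminate occurs in \<open>U\<close>.\<close>

lemma exact_base:
  assumes z: "poly_chain p z" "wboundary V j z = (\<lambda>\<tau>. 0)" and p: "p \<ge> 2"
  shows "\<exists>w. poly_chain (p + 1) w \<and> wboundary V j w = z \<and>
    (\<forall>\<sigma> M. Poly_Mapping.lookup (w \<sigma>) M \<noteq> 0 \<longrightarrow> (\<exists>\<sigma>' M'. Poly_Mapping.lookup (z \<sigma>') M' \<noteq> 0 \<and>
      (\<forall>l. l \<noteq> j \<longrightarrow> group_degree l M = group_degree l M') \<and> group_degree j M' = Suc (group_degree j M)))"
proof -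
  define supp where "supp U = {v \<in> V. expo U j v \<ge> 1}" for U
  define Y where "Y U = induced_subcomplex X (supp U)" for U
  \<comment> \<open>\<open>c U\<close> is the piece of multidegree \<open>U\<close>. Subtraction of
    exponents is truncated, so the condition \<open>\<sigma> \<subseteq> supp U\<close> ensures that
    \<open>face_mon j \<sigma>\<close> really divides \<open>U\<close>.\<close>
  define c where "c U \<sigma> = (if finite \<sigma> \<and> \<sigma> \<subseteq> supp U then Poly_Mapping.lookup (z \<sigma>) (U - face_mon j \<sigma>) else 0)"
    for U \<sigma>
  have supp_V: "supp U \<subseteq> V" and fin_supp: "finite (supp U)" for U
    using finV by (auto simp: supp_def)
  have c_face: "\<sigma> \<in> faces p (Y U)" if "c U \<sigma> \<noteq> 0" for U \<sigma>
  proof -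
    have "z \<sigma> \<noteq> 0" using that by (auto simp: c_def split: if_splits)
    then show ?thesis
      using that z(1) unfolding poly_chain_def c_def Y_def induced_subcomplex_def faces_def
      by (auto split: if_splits)
  qed
  have Y_sub: "\<sigma> \<subseteq> supp U" if "\<sigma> \<in> faces q (Y U)" for \<sigma> q U
    using that by (auto simp: Y_def induced_subcomplex_def faces_def)
  have sub_add: "face_mon j \<sigma> + (U - face_mon j \<sigma>) = U" if "finite \<sigma>" "\<sigma> \<subseteq> supp U" for \<sigma> U
    using that by (intro monomial_eqI) (auto simp: expo_face_mon supp_def)
  have lookup_wboundary: "Poly_Mapping.lookup (wboundary V j y \<tau>) M
      = (\<Sum>v\<in>supp (M + face_mon j \<tau>) - \<tau>. face_sign \<tau> v * Poly_Mapping.lookup (y (insert v \<tau>)) (M - indet_mon j v))"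
    if \<tau>: "\<tau> \<subseteq> V" for y :: "'a set \<Rightarrow> ('a, 'k) indet_poly" and \<tau> M
  proof -
    have fin\<tau>: "finite \<tau>" using \<tau> finV finite_subset by blast
    have "Poly_Mapping.lookup (wboundary V j y \<tau>) M
      = (\<Sum>v\<in>V - \<tau>. if expo M j v \<ge> 1 then face_sign \<tau> v * Poly_Mapping.lookup (y (insert v \<tau>)) (M - indet_mon j v) else 0)"
      using \<tau> by (simp add: wboundary_def lookup_sum lookup_face_sign_mult lookup_indet_mult if_distrib cong: if_cong)
    also have "\<dots> = (\<Sum>v\<in>supp (M + face_mon j \<tau>) - \<tau>. face_sign \<tau> v * Poly_Mapping.lookup (y (insert v \<tau>)) (M - indet_mon j v))"
      using finV fin\<tau> by (intro sum.mono_neutral_cong_right) (auto simp: supp_def expo_face_mon)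
    finally show ?thesis .
  qed
  have "c U \<in> cycles p (Y U)" for U
  proof -
    have "boundary p (Y U) (c U) \<tau> = 0" for \<tau>
    proof (cases "\<tau> \<subseteq> supp U")
      case True
      have fin\<tau>: "finite \<tau>" using True fin_supp finite_subset by blast
      let ?M = "U - face_mon j \<tau>"
      have U: "?M + face_mon j \<tau> = U" using sub_add[OF fin\<tau> True] by (simp add: add.commute)
      have "boundary p (Y U) (c U) \<tau> = (\<Sum>v\<in>supp U - \<tau>. face_sign \<tau> v * c U (insert v \<tau>))"
        using c_face Y_sub by (intro boundary_eq fin_supp True)
      also have "\<dots> = (\<Sum>v\<in>supp (?M + face_mon j \<tau>) - \<tau>. face_sign \<tau> v * Poly_Mapping.lookup (z (insert v \<tau>)) (?M - indet_mon j v))"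
      proof (intro sum.cong)
        fix v assume v: "v \<in> supp (?M + face_mon j \<tau>) - \<tau>"
        have "face_mon j (insert v \<tau>) = face_mon j \<tau> + indet_mon j v"
          using v fin\<tau> by (simp add: face_mon_def add.commute)
        then show "face_sign \<tau> v * c U (insert v \<tau>) = face_sign \<tau> v * Poly_Mapping.lookup (z (insert v \<tau>)) (?M - indet_mon j v)"
          using v True fin\<tau> by (simp add: c_def U diff_diff_add)
      qed (simp add: U)
      also have "\<dots> = Poly_Mapping.lookup (wboundary V j z \<tau>) ?M"
        using True supp_V by (intro lookup_wboundary[symmetric]) blast
      finally show ?thesis using z(2) by simp
    next
      case False
      have "boundary p (Y U) (c U) \<tau> = 0"
        unfolding boundary_def
      proof (intro sum.neutral ballI)
        fix \<sigma> i assume "\<sigma> \<in> faces p (Y U)" 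
        then have "\<not> \<tau> \<subseteq> \<sigma>" using False Y_sub by blast
        then show "(if \<tau> = \<sigma> - {sorted_list_of_set \<sigma> ! i} then (-1) ^ i * c U \<sigma> else 0) = 0" by auto
      qed
      then show ?thesis .
    qed
    then show ?thesis
      using c_face by (auto simp: cycles_def chain_group_def)
  qed
  then have "\<exists>e. e \<in> carrier (chain_group (p + 1) (Y U)) \<and> boundary (p + 1) (Y U) e = c U" for U
    using leray_exact[OF leray2 p supp_V] unfolding Y_def by metis
  then obtain e0 where e0: "e0 U \<in> carrier (chain_group (p + 1) (Y U))"
    "boundary (p + 1) (Y U) (e0 U) = c U" for U by metis
  \<comment> \<open>Choosing 0 as the primitive of 0 leaves only the finitely many multidegrees in
    \<open>UU\<close>, so that the \<open>e U\<close> can be assembled to polynomials.\<close>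
  define e where "e U = (if c U = (\<lambda>\<sigma>. 0) then (\<lambda>\<sigma>. 0) else e0 U)" for U
  have e: "e U \<in> carrier (chain_group (p + 1) (Y U))" "boundary (p + 1) (Y U) (e U) = c U" for U
    using e0 by (auto simp: e_def chain_group_def boundary_def cong: if_cong)
  have e_face: "\<sigma> \<in> faces (p + 1) (Y U)" if "e U \<sigma> \<noteq> 0" for U \<sigma>
    using e(1) that by (auto simp: chain_group_def)
  have e_nz: "\<exists>\<sigma>' M'. Poly_Mapping.lookup (z \<sigma>') M' \<noteq> 0 \<and> M' + face_mon j \<sigma>' = U" if nz: "e U \<sigma> \<noteq> 0" for U \<sigma>
  proof -
    have "c U \<noteq> (\<lambda>\<sigma>. 0)" using nz by (auto simp: e_def)
    then obtain \<sigma>' where "c U \<sigma>' \<noteq> 0" by blast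
    then show ?thesis using sub_add[of \<sigma>' U]
      by (intro exI[of _ \<sigma>'] exI[of _ "U - face_mon j \<sigma>'"]) (auto simp: c_def add.commute split: if_splits)
  qed
  define UU where "UU = (\<Union>\<sigma>'\<in>faces p X. (\<lambda>M. M + face_mon j \<sigma>') ` Poly_Mapping.keys (z \<sigma>'))"
  have finUU: "finite UU" unfolding UU_def using finite_faces by auto
  have e_UU: "U \<in> UU" if "e U \<sigma> \<noteq> 0" for U \<sigma>
    using e_nz[OF that] z(1) unfolding UU_def poly_chain_def
    by (metis (no_types, lifting) UN_I image_eqI in_keys_iff lookup_zero)
  define w where "w \<sigma> = Abs_poly_mapping (\<lambda>M. e (M + face_mon j \<sigma>) \<sigma>)" for \<sigma>
  have lookup_w: "Poly_Mapping.lookup (w \<sigma>) M = e (M + face_mon j \<sigma>) \<sigma>" for \<sigma> M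
  proof -
    have "finite {M. e (M + face_mon j \<sigma>) \<sigma> \<noteq> 0}"
    proof (rule finite_subset)
      show "{M. e (M + face_mon j \<sigma>) \<sigma> \<noteq> 0} \<subseteq> (\<lambda>M. M + face_mon j \<sigma>) -` UU" using e_UU by auto
      show "finite ((\<lambda>M. M + face_mon j \<sigma>) -` UU)"
        using finUU by (rule finite_vimageI) (auto simp: inj_on_def)
    qed
    then show ?thesis by (simp add: w_def)
  qed
  have w_chain: "poly_chain (p + 1) w"
    unfolding poly_chain_def
  proof (intro allI impI)
    fix \<sigma> assume "w \<sigma> \<noteq> 0"
    then obtain M where "e (M + face_mon j \<sigma>) \<sigma> \<noteq> 0"
      by (metis lookup_w lookup_zero poly_mapping_eqI)
    then show "\<sigma> \<in> faces (p + 1) X"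
      using e_face by (auto simp: faces_def Y_def induced_subcomplex_def)
  qed
  moreover have "wboundary V j w = z"
  proof
    fix \<tau>
    show "wboundary V j w \<tau> = z \<tau>"
    proof (cases "\<tau> \<subseteq> V")
      case True
      have fin\<tau>: "finite \<tau>" using True finV finite_subset by blast
      show ?thesis
      proof (rule poly_mapping_eqI)
        fix M
        let ?U = "M + face_mon j \<tau>"
        have \<tau>U: "\<tau> \<subseteq> supp ?U" using True fin\<tau> by (auto simp: supp_def expo_face_mon)
        have "Poly_Mapping.lookup (wboundary V j w \<tau>) M
            = (\<Sum>v\<in>supp ?U - \<tau>. face_sign \<tau> v * e (M - indet_mon j v + face_mon j (insert v \<tau>)) (insert v \<tau>))"
          by (simp add: lookup_wboundary[OF True] lookup_w)
        also have "\<dots> = (\<Sum>v\<in>supp ?U - \<tau>. face_sign \<tau> v * e ?U (insert v \<tau>))"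
        proof (intro sum.cong refl)
          fix v assume v: "v \<in> supp ?U - \<tau>"
          then have "expo M j v \<ge> 1" using fin\<tau> by (auto simp: supp_def expo_face_mon)
          then have "M - indet_mon j v + face_mon j (insert v \<tau>) = ?U"
            using v fin\<tau> indet_mon_minus_add[of M j v] by (simp add: face_mon_def add.assoc[symmetric])
          then show "face_sign \<tau> v * e (M - indet_mon j v + face_mon j (insert v \<tau>)) (insert v \<tau>) = face_sign \<tau> v * e ?U (insert v \<tau>)"
            by simp
        qed
        also have "\<dots> = boundary (p + 1) (Y ?U) (e ?U) \<tau>"
          using e_face Y_sub by (intro boundary_eq[symmetric] fin_supp \<tau>U)
        also have "\<dots> = Poly_Mapping.lookup (z \<tau>) M"
          unfolding e(2) using \<tau>U fin\<tau> by (simp add: c_def)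
        finally show "Poly_Mapping.lookup (wboundary V j w \<tau>) M = Poly_Mapping.lookup (z \<tau>) M" .
      qed
    next
      case False
      then have "z \<tau> = 0" using z(1) facesD unfolding poly_chain_def by blast
      then show ?thesis using False by (simp add: wboundary_def)
    qed
  qed
  moreover have "\<exists>\<sigma>' M'. Poly_Mapping.lookup (z \<sigma>') M' \<noteq> 0 \<and>
      (\<forall>l. l \<noteq> j \<longrightarrow> group_degree l M = group_degree l M') \<and> group_degree j M' = Suc (group_degree j M)"
    if "Poly_Mapping.lookup (w \<sigma>) M \<noteq> 0" for \<sigma> M
  proof -
    have nz: "e (M + face_mon j \<sigma>) \<sigma> \<noteq> 0" using that lookup_w by simp
    obtain \<sigma>' M' where M': "Poly_Mapping.lookup (z \<sigma>') M' \<noteq> 0" "M' + face_mon j \<sigma>' = M + face_mon j \<sigma>"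
      using e_nz[OF nz] by blast
    have "z \<sigma>' \<noteq> 0" "w \<sigma> \<noteq> 0" using M'(1) that by auto
    then have f: "\<sigma>' \<in> faces p X" "\<sigma> \<in> faces (p + 1) X"
      using z(1) w_chain unfolding poly_chain_def by auto
    have deg: "group_degree l M' + group_degree l (face_mon j \<sigma>') = group_degree l M + group_degree l (face_mon j \<sigma>)" for l
      using arg_cong[OF M'(2), of "group_degree l"] by (simp add: group_degree_add)
    \<comment> \<open>Both terms have the same multidegree and \<open>\<sigma>\<close> has one
      vertex more than \<open>\<sigma>'\<close>, so its coefficient has \<open>j\<close>-degree one
      less.\<close>
    have "group_degree l M' = (if l = j then Suc (group_degree l M) else group_degree l M)" for l
      using deg[of l] facesD[OF f(1)] facesD[OF f(2)] by (simp add: group_degree_face_mon split: if_splits)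
    then show ?thesis using M'(1)
      by (intro exI[of _ \<sigma>'] exI[of _ M']) simp
  qed
  ultimately show ?thesis by blast
qed

end

section \<open>Common kernels of several weighted boundaries\<close>

context two_leray
begin

definition common_kernel :: "nat set \<Rightarrow> nat \<Rightarrow> ('a set \<Rightarrow> ('a, 'k) indet_poly) set" where
  "common_kernel I p = {z. poly_chain p z \<and> (\<forall>i\<in>I. wboundary V i z = (\<lambda>\<tau>. 0))}"

definition degree_less :: "nat \<Rightarrow> nat \<Rightarrow> ('a set \<Rightarrow> ('a, 'k) indet_poly) \<Rightarrow> bool" where
  "degree_less l D z \<longleftrightarrow> (\<forall>\<sigma> M. Poly_Mapping.lookup (z \<sigma>) M \<noteq> 0 \<longrightarrow> group_degree l M < D)"

text \<open>All families are controlled, not only \<open>j\<close>: the zigzag takes a primitive for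
  another operator on the way, which must not raise the \<open>j\<close>-degree. Upper bounds
  replace degrees since the zero chain has no degree.\<close>

definition degree_drops :: "nat \<Rightarrow> ('a set \<Rightarrow> ('a, 'k) indet_poly) \<Rightarrow> ('a set \<Rightarrow> ('a, 'k) indet_poly) \<Rightarrow> bool" where
  "degree_drops j z w \<longleftrightarrow> (\<forall>l D. l \<noteq> j \<longrightarrow> degree_less l D z \<longrightarrow> degree_less l D w) \<and> (\<forall>D. degree_less j (Suc D) z \<longrightarrow> degree_less j D w)"

lemma poly_chain_zero: "poly_chain p (\<lambda>\<sigma>. 0)"
  by (simp add: poly_chain_def)

lemma poly_chain_add: "poly_chain p z \<Longrightarrow> poly_chain p w \<Longrightarrow> poly_chain p (\<lambda>\<sigma>. z \<sigma> + w \<sigma>)"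
  unfolding poly_chain_def by (metis add_0)

lemma poly_chain_wboundary:
  assumes "poly_chain (Suc p) z" shows "poly_chain p (wboundary V j z)"
  unfolding poly_chain_def
proof (intro allI impI)
  fix \<tau> assume nz: "wboundary V j z \<tau> \<noteq> 0"
  then have "(\<Sum>v\<in>V - \<tau>. face_sign \<tau> v * (indet j v * z (insert v \<tau>))) \<noteq> 0"
    by (auto simp: wboundary_def split: if_splits)
  then obtain v where v: "v \<in> V - \<tau>" "z (insert v \<tau>) \<noteq> 0"
    by (metis (no_types, lifting) mult_zero_right sum.neutral)
  have "insert v \<tau> \<in> faces (Suc p) X" using v(2) assms by (auto simp: poly_chain_def)
  then show "\<tau> \<in> faces p X" using v(1) face_closed[of "insert v \<tau>" \<tau>] by (auto simp: faces_def)
qed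

lemma degree_less_zero [simp]: "degree_less l D (\<lambda>\<sigma>. 0)"
  by (simp add: degree_less_def)

lemma degree_less_0_iff: "degree_less l 0 z \<longleftrightarrow> z = (\<lambda>\<sigma>. 0)"
proof
  assume "degree_less l 0 z"
  then have "Poly_Mapping.lookup (z \<sigma>) M = 0" for \<sigma> M by (auto simp: degree_less_def)
  then show "z = (\<lambda>\<sigma>. 0)" by (intro ext poly_mapping_eqI) simp
qed simp

lemma degree_less_add: "degree_less l D z \<Longrightarrow> degree_less l D w \<Longrightarrow> degree_less l D (\<lambda>\<sigma>. z \<sigma> + w \<sigma>)"
  unfolding degree_less_def lookup_add by (metis add_0)

lemma lookup_wboundary_nz:
  assumes "Poly_Mapping.lookup (wboundary V j z \<tau>) M \<noteq> 0"
  obtains v where "v \<in> V" "expo M j v \<ge> 1" "Poly_Mapping.lookup (z (insert v \<tau>)) (M - indet_mon j v) \<noteq> 0"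
proof -
  have "(\<Sum>v\<in>V - \<tau>. Poly_Mapping.lookup (face_sign \<tau> v * (indet j v * z (insert v \<tau>))) M) \<noteq> 0"
    using assms by (auto simp: wboundary_def lookup_sum split: if_splits)
  then obtain v where v: "v \<in> V - \<tau>" "Poly_Mapping.lookup (face_sign \<tau> v * (indet j v * z (insert v \<tau>))) M \<noteq> 0"
    by (meson sum.neutral)
  then show ?thesis using that[of v] by (auto simp: lookup_face_sign_mult lookup_indet_mult dest: mult_not_zero split: if_splits)
qed

lemma group_degree_minus_indet_mon:
  assumes "v \<in> V" "expo M j v \<ge> 1"
  shows "group_degree l M = group_degree l (M - indet_mon j v) + (if l = j then 1 else 0)"
proof -
  have "indet_mon j v = face_mon j {v}" by (simp add: face_mon_def)
  then have "group_degree l (M - indet_mon j v + indet_mon j v) = group_degree l (M - indet_mon j v) + (if l = j then 1 else 0)"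
    using assms by (simp add: group_degree_add group_degree_face_mon)
  then show ?thesis using indet_mon_minus_add[OF assms(2)] by simp
qed

lemma degree_less_wboundary:
  assumes "degree_less l D z" shows "degree_less l (if l = j then Suc D else D) (wboundary V j z)"
  unfolding degree_less_def
proof (intro allI impI)
  fix \<tau> M assume "Poly_Mapping.lookup (wboundary V j z \<tau>) M \<noteq> 0"
  then obtain v where v: "v \<in> V" "expo M j v \<ge> 1" "Poly_Mapping.lookup (z (insert v \<tau>)) (M - indet_mon j v) \<noteq> 0"
    by (rule lookup_wboundary_nz)
  from v(3) have "group_degree l (M - indet_mon j v) < D" using assms by (auto simp: degree_less_def)
  then show "group_degree l M < (if l = j then Suc D else D)"
    using group_degree_minus_indet_mon[OF v(1,2), of l] by (simp split: if_splits)
qed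

lemma degree_less_exists:
  assumes "poly_chain p z" shows "\<exists>D. degree_less l D z"
proof -
  let ?S = "\<Union>\<sigma>\<in>faces p X. group_degree l ` Poly_Mapping.keys (z \<sigma>)"
  have fin: "finite ?S" using finite_faces by auto
  have "degree_less l (Suc (Max ?S)) z"
    unfolding degree_less_def
  proof (intro allI impI)
    fix \<sigma> M assume nz: "Poly_Mapping.lookup (z \<sigma>) M \<noteq> 0"
    then have "z \<sigma> \<noteq> 0" by auto
    then have "\<sigma> \<in> faces p X" using assms by (auto simp: poly_chain_def)
    then have "group_degree l M \<in> ?S" using nz by (intro UN_I[of \<sigma>] imageI) (simp_all add: in_keys_iff)
    then show "group_degree l M < Suc (Max ?S)" using fin Max_ge[OF fin] by (simp add: less_Suc_eq_le)
  qed
  then show ?thesis by blast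
qed

text \<open>The zigzag: if \<open>y = d\<^sub>j w\<^sub>0\<close>, then \<open>d\<^sub>i w\<^sub>0\<close> has smaller \<open>j\<close>-degree and is again killed by
  \<open>d\<^sub>i\<close> and \<open>d\<^sub>j\<close>; inductively \<open>d\<^sub>i w\<^sub>0 = d\<^sub>j (d\<^sub>i u)\<close>, and \<open>w\<^sub>0 + d\<^sub>j u\<close> is a preimage of \<open>y\<close> killed
  by \<open>d\<^sub>i\<close>.\<close>

lemma common_kernel_exact:
  assumes "finite I" "j \<notin> I" "p \<ge> 2" "z \<in> common_kernel (insert j I) p"
  shows "\<exists>w \<in> common_kernel I (Suc p). wboundary V j w = z \<and> degree_drops j z w"
  using assms
proof (induction I arbitrary: j p z rule: finite_induct)
  case empty
  then have z: "poly_chain p z" "wboundary V j z = (\<lambda>\<tau>. 0)" by (auto simp: common_kernel_def)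
  obtain w where w: "poly_chain (p + 1) w" "wboundary V j w = z"
    "\<And>\<sigma> M. Poly_Mapping.lookup (w \<sigma>) M \<noteq> 0 \<Longrightarrow> \<exists>\<sigma>' M'. Poly_Mapping.lookup (z \<sigma>') M' \<noteq> 0 \<and>
      (\<forall>l. l \<noteq> j \<longrightarrow> group_degree l M = group_degree l M') \<and> group_degree j M' = Suc (group_degree j M)"
    using exact_base[OF z empty.prems(2)] by blast
  have "degree_drops j z w"
    unfolding degree_drops_def degree_less_def using w(3) by (metis Suc_less_eq)
  then show ?case using w(1,2) by (auto simp: common_kernel_def)
next
  case (insert i I)
  have ij: "i \<noteq> j" "j \<notin> I" using insert.prems by auto
  have "\<exists>w \<in> common_kernel (insert i I) (Suc p). wboundary V j w = y \<and> degree_drops j y w"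
    if "degree_less j D y" "y \<in> common_kernel (insert j (insert i I)) p" for D y
    using that
  proof (induction D arbitrary: y)
    case 0
    then have "y = (\<lambda>\<sigma>. 0)" by (simp add: degree_less_0_iff)
    then show ?case
      by (intro bexI[of _ "\<lambda>\<sigma>. 0"]) (auto simp: degree_drops_def common_kernel_def poly_chain_zero)
  next
    case (Suc D)
    show ?case
    proof (cases "y = (\<lambda>\<sigma>. 0)")
      case True
      then show ?thesis
        by (intro bexI[of _ "\<lambda>\<sigma>. 0"]) (auto simp: degree_drops_def common_kernel_def poly_chain_zero)
    next
      case False
      have yk: "y \<in> common_kernel (insert j I) p" "wboundary V i y = (\<lambda>\<tau>. 0)"
        using Suc.prems(2) by (auto simp: common_kernel_def)
      obtain w0 where w0: "w0 \<in> common_kernel I (Suc p)" "wboundary V j w0 = y" "degree_drops j y w0"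
        using insert.IH[OF ij(2) insert.prems(2) yk(1)] by blast
      let ?y' = "wboundary V i w0"
      have w0I: "poly_chain (Suc p) w0" "\<And>i'. i' \<in> I \<Longrightarrow> wboundary V i' w0 = (\<lambda>\<tau>. 0)"
        using w0(1) by (auto simp: common_kernel_def)
      have "wboundary V j ?y' = (\<lambda>\<tau>. 0)"
        using wboundary_anticommute[OF finV, of j i w0] w0(2) yk(2) by simp
      moreover have "wboundary V i' ?y' = (\<lambda>\<tau>. 0)" if "i' \<in> I" for i'
        using wboundary_anticommute[OF finV, of i' i w0] w0I(2)[OF that] by simp
      ultimately have y'k: "?y' \<in> common_kernel (insert j (insert i I)) p"
        using wboundary_wboundary_same[OF finV, of i w0] poly_chain_wboundary[OF w0I(1)] by (auto simp: common_kernel_def)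
      have w0_j: "degree_less j D' w0" if "degree_less j (Suc D') y" for D'
        using w0(3) that by (auto simp: degree_drops_def)
      have w0_l: "degree_less l D' w0" if "degree_less l D' y" "l \<noteq> j" for l D'
        using w0(3) that by (auto simp: degree_drops_def)
      \<comment> \<open>The primitive lost one \<open>j\<close>-degree and \<open>d_i\<close> with
        \<open>i \<noteq> j\<close> does not give it back, so the inner induction on
        \<open>D\<close> applies to \<open>?y'\<close>.\<close>
      have y'_j: "degree_less j D' ?y'" if "degree_less j (Suc D') y" for D'
        using degree_less_wboundary[OF w0_j[OF that], of i] ij by simp
      obtain w1 where w1: "w1 \<in> common_kernel (insert i I) (Suc p)" "wboundary V j w1 = ?y'" "degree_drops j ?y' w1"
        using Suc.IH[OF y'_j[OF Suc.prems(1)] y'k] by blast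
      obtain u where u: "u \<in> common_kernel I (Suc (Suc p))" "wboundary V i u = w1" "degree_drops i w1 u"
        using insert.IH[OF insert.hyps(2) _ w1(1)] insert.prems(2) by auto
      have uI: "poly_chain (Suc (Suc p)) u" "\<And>i'. i' \<in> I \<Longrightarrow> wboundary V i' u = (\<lambda>\<tau>. 0)"
        using u(1) by (auto simp: common_kernel_def)
      define w where "w \<sigma> = w0 \<sigma> + wboundary V j u \<sigma>" for \<sigma>
      have w_eq: "w = (\<lambda>\<sigma>. w0 \<sigma> + wboundary V j u \<sigma>)" by (simp add: w_def fun_eq_iff)
      \<comment> \<open>\<open>d_i w = ?y' + d_i (d_j u) = ?y' - d_j (d_i u) = ?y' - d_j w1 =
        0\<close>.\<close>
      have "wboundary V i w = (\<lambda>\<tau>. 0)"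
        unfolding w_eq wboundary_add wboundary_anticommute[OF finV, of i j u] u(2) w1(2) by simp
      moreover have "wboundary V i' w = (\<lambda>\<tau>. 0)" if "i' \<in> I" for i'
        unfolding w_eq wboundary_add wboundary_anticommute[OF finV, of i' j u] using w0I(2) uI(2) that by simp
      moreover have "poly_chain (Suc p) w"
        unfolding w_eq using w0I(1) poly_chain_wboundary[OF uI(1)] by (rule poly_chain_add)
      ultimately have wk: "w \<in> common_kernel (insert i I) (Suc p)" by (auto simp: common_kernel_def)
      have wy: "wboundary V j w = y"
        unfolding w_eq wboundary_add wboundary_wboundary_same[OF finV] using w0(2) by simp
      have "degree_less j D' w" if D': "degree_less j (Suc D') y" for D'
      \<comment> \<open>The summand \<open>wboundary V j u\<close> needs room for one more
        \<open>j\<close>-degree than \<open>u\<close>. The bound \<open>D' = 0\<close> would force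
        \<open>w0 = 0\<close> and so \<open>y = 0\<close>, which was excluded.\<close>
      proof (cases D')
        case 0
        then have "w0 = (\<lambda>\<sigma>. 0)" using w0_j[OF D'] degree_less_0_iff by simp
        then show ?thesis using w0(2) False by simp
      next
        case [simp]: (Suc D'')
        have "degree_less j D'' w1" using y'_j[OF D'] w1(3) by (auto simp: degree_drops_def)
        then have "degree_less j D'' u" using u(3) ij(1) by (auto simp: degree_drops_def)
        from degree_less_wboundary[OF this, of j] show ?thesis
          unfolding w_eq using w0_j[OF D'] by (intro degree_less_add) auto
      qed
      moreover have "degree_less l D' w" if l: "l \<noteq> j" and D': "degree_less l D' y" for l D'
      proof -
        have "degree_less l (if l = i then Suc D' else D') ?y'"
          using degree_less_wboundary[OF w0_l[OF D' l], of i] .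
        then have "degree_less l (if l = i then Suc D' else D') w1" using w1(3) l by (auto simp: degree_drops_def)
        then have "degree_less l D' u" using u(3) by (auto simp: degree_drops_def split: if_splits)
        from degree_less_wboundary[OF this, of j] show ?thesis
          unfolding w_eq using w0_l[OF D' l] l by (intro degree_less_add) auto
      qed
      ultimately show ?thesis using wk wy by (auto simp: degree_drops_def)
    qed
  qed
  moreover obtain D where "degree_less j D z"
    using degree_less_exists[of p z j] insert.prems(3) by (auto simp: common_kernel_def)
  ultimately show ?case using insert.prems(3) by blast
qed

text \<open>Exactness lifts \<open>z\<close> one dimension at the cost of one operator, and a
  preimage of a nonzero chain is nonzero. After \<open>s\<close> lifts there is a nonzero chain of
  dimension \<open>p + s\<close>, which needs a face to live on.\<close>

lemma common_kernel_nonzero_faces: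
  assumes "z \<in> common_kernel {..<s} p" "z \<noteq> (\<lambda>\<sigma>. 0)" "p \<ge> 2"
  shows "faces (p + s) X \<noteq> {}"
  using assms
proof (induction s arbitrary: z p)
  case 0
  then show ?case by (auto simp: common_kernel_def poly_chain_def fun_eq_iff)
next
  case (Suc s)
  obtain w where "w \<in> common_kernel {..<s} (Suc p)" "wboundary V s w = z"
    using common_kernel_exact[of "{..<s}" s p z] Suc.prems by (auto simp: lessThan_Suc)
  then show ?case using Suc.IH[of w "Suc p"] Suc.prems by fastforce
qed

end

section \<open>The number of triangles of a 2-Leray complex\<close>

text \<open>Look at a coefficient \<open>a\<^sub>w\<close> and a monomial of it of maximal degree in the diagonal
  indeterminates: in the equation of index \<open>idx w\<close> nothing can cancel its product with
  the diagonal indeterminate of \<open>w\<close>.\<close>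

lemma indet_independent:
  fixes a :: "'a \<Rightarrow> ('a, 'k::comm_ring_1) indet_poly"
  assumes Y: "finite Y" "card Y \<le> s"
    and rel: "\<And>i. i < s \<Longrightarrow> (\<Sum>w\<in>Y. indet i w * a w) = 0" and "w \<in> Y"
  shows "a w = 0"
proof (rule ccontr)
  assume "a w \<noteq> 0"
  \<comment> \<open>Each vertex of \<open>Y\<close> gets an equation of its own, and
    \<open>card Y \<le> s\<close> provides enough of them. The diagonal indeterminates are the
    \<open>indet (idx v) v\<close>, and \<open>dw\<close> is the degree in these.\<close>
  obtain idx where bij: "bij_betw idx Y {0..<card Y}"
    using ex_bij_betw_finite_nat[OF Y(1)] by blast
  define dw where "dw M = (\<Sum>v\<in>Y. expo M (idx v) v)" for M :: "'a monomial"
  have dw_add: "dw (M + N) = dw M + dw N" for M N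
    by (simp add: dw_def sum.distrib)
  have dw_indet_mon: "dw (indet_mon i v) = (if idx v = i then 1 else 0)" if "v \<in> Y" for i v
  proof -
    have "dw (indet_mon i v) = (\<Sum>u\<in>Y. if u = v then (if idx v = i then 1 else 0) else 0)"
      unfolding dw_def by (intro sum.cong refl) (auto simp: expo_indet_mon)
    then show ?thesis using that Y(1) by simp
  qed
  define P where "P = Sigma Y (\<lambda>w. Poly_Mapping.keys (a w))"
  have "finite P" using Y(1) by (auto simp: P_def)
  moreover have "P \<noteq> {}"
    using \<open>a w \<noteq> 0\<close> \<open>w \<in> Y\<close> unfolding P_def by (metis Sigma_empty_iff keys_eq_empty)
  ultimately have "Max ((dw \<circ> snd) ` P) \<in> (dw \<circ> snd) ` P"
    by (intro Max_in) auto
  then obtain q where q: "q \<in> P" "dw (snd q) = Max ((dw \<circ> snd) ` P)"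
    by (metis (no_types, lifting) imageE o_apply)
  have q_max: "dw (snd q') \<le> dw (snd q)" if "q' \<in> P" for q'
    unfolding q(2) using \<open>finite P\<close> that by (intro Max_ge) auto
  obtain j M where jM: "q = (j, M)" by fastforce
  have j: "j \<in> Y" "Poly_Mapping.lookup (a j) M \<noteq> 0"
    using q(1) by (auto simp: jM P_def in_keys_iff)
  have max: "dw M' \<le> dw M" if "w \<in> Y" "Poly_Mapping.lookup (a w) M' \<noteq> 0" for w M'
    using q_max[of "(w, M')"] that by (auto simp: jM P_def in_keys_iff)
  let ?i = "idx j"
  have "?i \<in> {0..<card Y}" using bij j(1) by (rule bij_betw_apply)
  then have i: "?i < s" using Y(2) by simp
  \<comment> \<open>A term with \<open>w \<noteq> j\<close> at this monomial would contain the
    off-diagonal \<open>indet ?i w\<close>; dividing by it keeps the diagonal degree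
    \<open>dw M + 1\<close>, which exceeds the maximum.\<close>
  let ?N = "M + indet_mon ?i j"
  have other: "Poly_Mapping.lookup (indet ?i w * a w) ?N = 0" if w: "w \<in> Y" "w \<noteq> j" for w
  proof (rule ccontr)
    assume "Poly_Mapping.lookup (indet ?i w * a w) ?N \<noteq> 0"
    then have x: "expo ?N ?i w \<ge> 1" "Poly_Mapping.lookup (a w) (?N - indet_mon ?i w) \<noteq> 0"
      by (auto simp: lookup_indet_mult split: if_splits)
    have "idx w \<noteq> ?i" using w j(1) bij by (auto simp: bij_betw_def inj_on_def)
    then have "dw (?N - indet_mon ?i w) = dw M + 1"
      using arg_cong[OF indet_mon_minus_add[OF x(1)], of dw] w(1) j(1) by (simp add: dw_add dw_indet_mon)
    then show False using max[OF w(1) x(2)] by simp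
  qed
  have "0 = (\<Sum>w\<in>Y. Poly_Mapping.lookup (indet ?i w * a w) ?N)"
    using rel[OF i] by (simp flip: lookup_sum)
  also have "\<dots> = Poly_Mapping.lookup (indet ?i j * a j) ?N"
    using Y(1) j(1) other by (simp add: sum.remove)
  also have "\<dots> = Poly_Mapping.lookup (a j) M"
    by (simp add: lookup_indet_mult expo_indet_mon)
  finally show False using j(2) by simp
qed

text \<open>Gaussian elimination by cross-multiplication, which needs no division and so works over
  a polynomial ring. \<open>u0\<close> is the pivot and \<open>c'\<close> the system after its
  elimination; going back multiplies the solution by the nonzero pivot coefficient, so it stays
  nonzero.\<close>

lemma underdetermined_system:
  fixes c :: "'e \<Rightarrow> 'u \<Rightarrow> 'r::idom"
  assumes "finite E" "finite U" "card E < card U"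
  shows "\<exists>x. (\<exists>u\<in>U. x u \<noteq> 0) \<and> (\<forall>e\<in>E. (\<Sum>u\<in>U. c e u * x u) = 0)"
  using assms
proof (induction E arbitrary: U c rule: finite_induct)
  case empty
  then have "U \<noteq> {}" by auto
  then show ?case by (intro exI[of _ "\<lambda>_. 1"]) auto
next
  case (insert e E)
  show ?case
  proof (cases "\<forall>u\<in>U. c e u = 0")
    case True
    then show ?thesis using insert.IH[of U c] insert.prems insert.hyps by auto
  next
    case False
    then obtain u0 where u0: "u0 \<in> U" "c e u0 \<noteq> 0" by blast
    let ?U = "U - {u0}"
    define c' where "c' f u = c e u0 * c f u - c f u0 * c e u" for f u
    have "card E < card ?U" using insert u0 by simp
    then obtain x where x: "\<exists>u\<in>?U. x u \<noteq> 0" "\<And>f. f \<in> E \<Longrightarrow> (\<Sum>u\<in>?U. c' f u * x u) = 0"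
      using insert.IH[of ?U c'] insert.prems by auto
    define x' where "x' u = (if u = u0 then - (\<Sum>u\<in>?U. c e u * x u) else c e u0 * x u)" for u
    have eq: "(\<Sum>u\<in>U. c f u * x' u) = (\<Sum>u\<in>?U. c' f u * x u)" for f
    proof -
      have "(\<Sum>u\<in>U. c f u * x' u) = c f u0 * x' u0 + (\<Sum>u\<in>?U. c f u * x' u)"
        using u0 insert.prems by (simp add: sum.remove)
      also have "\<dots> = (\<Sum>u\<in>?U. - (c f u0 * (c e u * x u))) + (\<Sum>u\<in>?U. c f u * (c e u0 * x u))"
        by (simp add: x'_def sum_distrib_left sum_negf)
      also have "\<dots> = (\<Sum>u\<in>?U. c' f u * x u)"
        by (simp add: c'_def algebra_simps flip: sum.distrib)
      finally show ?thesis .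
    qed
    have "(\<Sum>u\<in>U. c f u * x' u) = 0" if "f \<in> insert e E" for f
    proof (cases "f = e")
      case True
      then show ?thesis unfolding eq by (simp add: c'_def mult.commute)
    next
      case False
      then show ?thesis using that x(2) unfolding eq by blast
    qed
    moreover have "\<exists>u\<in>U. x' u \<noteq> 0" using x(1) u0(2) by (auto simp: x'_def)
    ultimately show ?thesis by blast
  qed
qed

context two_leray
begin

definition nbrs :: "'a \<Rightarrow> 'a set" where
  "nbrs v = {w \<in> V. w \<noteq> v \<and> {v, w} \<in> X}"

lemma finite_nbrs: "finite (nbrs v)"
  using finV by (simp add: nbrs_def)

lemma nbrs_sym: "w \<in> nbrs v \<Longrightarrow> v \<in> nbrs w"
  using face_sub by (auto simp: nbrs_def insert_commute)

text \<open>A chain annihilated by the operators of all groups vanishes, and annihilation by the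
  operator of group \<open>s\<close> on chains annihilated by the earlier ones is enforced by
  \<open>d - (s + 1)\<close> linear equations per vertex of back degree \<open>d\<close>.\<close>

theorem card_triangles_le:
  fixes \<pi> :: "'a \<Rightarrow> nat"
  assumes no: "faces (2 + r) X = {}" and inj: "inj_on \<pi> V"
  shows "card (faces 2 X) \<le> (\<Sum>v\<in>V. \<Sum>s<r. card {w \<in> nbrs v. \<pi> w < \<pi> v} - Suc s)"
proof (rule ccontr)
  define bk where "bk v = {w \<in> nbrs v. \<pi> w < \<pi> v}" for v
  have fin_bk: "finite (bk v)" for v using finite_nbrs by (simp add: bk_def)
  assume "\<not> ?thesis"
  then have less: "(\<Sum>v\<in>V. \<Sum>s<r. card (bk v) - Suc s) < card (faces 2 X)"
    by (simp add: bk_def)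
  \<comment> \<open>For group \<open>s\<close>, all but at most \<open>s + 1\<close> of the back
    edges of each vertex get an equation; the others will vanish by independence of the
    indeterminates.\<close>
  have "\<forall>s v. \<exists>Y. Y \<subseteq> bk v \<and> card Y = card (bk v) - Suc s"
    using obtain_subset_with_card_n diff_le_self by metis
  then obtain Y where "\<forall>s v. Y s v \<subseteq> bk v \<and> card (Y s v) = card (bk v) - Suc s"
    unfolding choice_iff by blast
  then have Y: "Y s v \<subseteq> bk v" "card (Y s v) = card (bk v) - Suc s" for s v
    by auto
  have fin_Y: "finite (Y s v)" for s v using Y(1) fin_bk finite_subset by blast
  define E where "E = (SIGMA v:V. SIGMA s:{..<r}. Y s v)"
  have finE: "finite E" unfolding E_def using finV fin_Y by auto
  have "card E = (\<Sum>v\<in>V. \<Sum>s<r. card (bk v) - Suc s)"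
    unfolding E_def using finV fin_Y by (simp add: card_SigmaI Y(2))
  then have lessE: "card E < card (faces 2 X)" using less by simp
  \<comment> \<open>The equation of \<open>(v, s, w)\<close> says that
    \<open>wboundary V s z\<close> vanishes on the edge \<open>{v, w}\<close>.\<close>
  define c :: "'a \<times> nat \<times> 'a \<Rightarrow> 'a set \<Rightarrow> ('a, 'k) indet_poly" where
    "c = (\<lambda>(v, s, w) \<sigma>. \<Sum>u\<in>V - {v, w}. if \<sigma> = insert u {v, w} then face_sign {v, w} u * indet s u else 0)"
  obtain x where x: "\<exists>\<sigma>\<in>faces 2 X. x \<sigma> \<noteq> 0" "\<forall>e\<in>E. (\<Sum>\<sigma>\<in>faces 2 X. c e \<sigma> * x \<sigma>) = 0"
    using underdetermined_system[OF finE finite_faces lessE] by blast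
  define z where "z \<sigma> = (if \<sigma> \<in> faces 2 X then x \<sigma> else 0)" for \<sigma>
  have z_chain: "poly_chain 2 z" by (auto simp: poly_chain_def z_def)
  have z_nz: "z \<noteq> (\<lambda>\<sigma>. 0)" using x(1) unfolding z_def by (metis (full_types))
  have z_eq: "wboundary V s z {v, w} = 0" if "v \<in> V" "s < r" "w \<in> Y s v" for v s w
  proof -
    have "w \<in> V" using that(3) Y(1) by (auto simp: bk_def nbrs_def)
    then have "wboundary V s z {v, w} = (\<Sum>u\<in>V - {v, w}. face_sign {v, w} u * (indet s u * z (insert u {v, w})))"
      using that by (simp add: wboundary_def)
    also have "\<dots> = (\<Sum>u\<in>V - {v, w}. \<Sum>\<sigma>\<in>faces 2 X. (if \<sigma> = insert u {v, w} then face_sign {v, w} u * indet s u else 0) * x \<sigma>)"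
    proof (intro sum.cong refl)
      fix u
      have "(\<Sum>\<sigma>\<in>faces 2 X. (if \<sigma> = insert u {v, w} then face_sign {v, w} u * indet s u else 0) * x \<sigma>)
        = (\<Sum>\<sigma>\<in>faces 2 X. if \<sigma> = insert u {v, w} then face_sign {v, w} u * indet s u * x (insert u {v, w}) else 0)"
        by (intro sum.cong refl) auto
      also have "\<dots> = face_sign {v, w} u * (indet s u * z (insert u {v, w}))"
        using finite_faces by (simp add: z_def mult.assoc)
      finally show "face_sign {v, w} u * (indet s u * z (insert u {v, w}))
        = (\<Sum>\<sigma>\<in>faces 2 X. (if \<sigma> = insert u {v, w} then face_sign {v, w} u * indet s u else 0) * x \<sigma>)" by simp
    qed
    also have "\<dots> = (\<Sum>\<sigma>\<in>faces 2 X. c (v, s, w) \<sigma> * x \<sigma>)"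
      by (subst sum.swap) (simp add: c_def sum_distrib_right)
    also have "\<dots> = 0" using x(2) that by (auto simp: E_def)
    finally show ?thesis .
  qed
  have step: "wboundary V s z = (\<lambda>\<tau>. 0)" if zk: "z \<in> common_kernel {..<s} 2" and s: "s < r" for s
  proof -
    let ?y = "wboundary V s z"
    have y_chain: "poly_chain 1 ?y" using poly_chain_wboundary[of 1 z s] z_chain by (simp add: numeral_2_eq_2)
    have y_ker: "wboundary V i ?y = (\<lambda>\<tau>. 0)" if "i < Suc s" for i
    proof (cases "i = s")
      case True
      then show ?thesis using wboundary_wboundary_same[OF finV] by simp
    next
      case False
      then have "wboundary V i z = (\<lambda>\<tau>. 0)" using zk that by (auto simp: common_kernel_def)
      then show ?thesis using wboundary_anticommute[OF finV, of i s z] by simp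
    qed
    \<comment> \<open>Vertices are treated from the last to the first. At \<open>v\<close> the edges
      to later vertices vanish by induction, those to \<open>Y s v\<close> by the equations, and the
      at most \<open>s + 1\<close> others by the \<open>s + 1\<close> relations that
      \<open>y_ker\<close> gives at \<open>{v}\<close>.\<close>
    have edges: "\<forall>w\<in>bk v. ?y {v, w} = 0" if "v \<in> V" for v
      using that
    proof (induction v rule: measure_induct_rule[of "\<lambda>v. Max (\<pi> ` V) - \<pi> v"])
      case (less v)
      define Z where "Z = bk v - Y s v"
      have finZ: "finite Z" using fin_bk by (simp add: Z_def)
      have cardZ: "card Z \<le> Suc s"
        using Y[of s v] fin_Y by (simp add: Z_def card_Diff_subset)
      have vanish: "?y {w, v} = 0" if w: "w \<in> V - {v}" "w \<notin> Z" for w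
      proof (rule ccontr)
        assume nz: "?y {w, v} \<noteq> 0"
        then have "{w, v} \<in> faces 1 X" using y_chain by (auto simp: poly_chain_def)
        then have wnb: "w \<in> nbrs v" using w(1) by (auto simp: nbrs_def faces_def insert_commute)
        show False
        proof (cases "\<pi> w < \<pi> v")
          case True
          then have "w \<in> Y s v" using wnb w(2) by (auto simp: Z_def bk_def)
          then show False using z_eq[OF less.prems s, of w] nz insert_commute[of w v] by simp
        next
          case False
          then have lt: "\<pi> v < \<pi> w" using inj w(1) less.prems by (metis DiffD1 DiffD2 inj_onD insertI1 linorder_neqE_nat)
          have "\<pi> w \<le> Max (\<pi> ` V)" using w(1) finV by auto
          then have "\<forall>u\<in>bk w. ?y {w, u} = 0" using less.IH[of w] lt w(1) by auto
          moreover have "v \<in> bk w" using nbrs_sym[OF wnb] lt by (simp add: bk_def)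
          ultimately show False using nz by blast
        qed
      qed
      have ZV: "Z \<subseteq> V - {v}" by (auto simp: Z_def bk_def nbrs_def)
      have rel: "(\<Sum>w\<in>Z. indet i w * (face_sign {v} w * ?y {w, v})) = 0" if i: "i < Suc s" for i
      proof -
        have "0 = wboundary V i ?y {v}" using y_ker[OF i] by simp
        also have "\<dots> = (\<Sum>w\<in>V - {v}. face_sign {v} w * (indet i w * ?y {w, v}))"
          using less.prems by (subst wboundary_def) simp
        also have "\<dots> = (\<Sum>w\<in>Z. indet i w * (face_sign {v} w * ?y {w, v}))"
          using finV ZV vanish by (intro sum.mono_neutral_cong_right) (auto simp: mult_ac)
        finally show ?thesis by simp
      qed
      have "face_sign {v} w * ?y {w, v} = 0" if "w \<in> Z" for w
        using indet_independent[OF finZ cardZ rel that] .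
      then have Z0: "?y {w, v} = 0" if "w \<in> Z" for w using that by simp
      show ?case
      proof
        fix w assume "w \<in> bk v"
        then have "w \<in> V - {v}" by (auto simp: bk_def nbrs_def)
        then show "?y {v, w} = 0" using vanish[of w] Z0[of w] by (auto simp: insert_commute)
      qed
    qed
    show ?thesis
    proof (rule ext, rule ccontr)
      fix \<tau> assume nz: "?y \<tau> \<noteq> 0"
      then have "\<tau> \<in> faces 1 X" using y_chain by (auto simp: poly_chain_def)
      then have \<tau>: "card \<tau> = 2" "\<tau> \<in> X" "\<tau> \<subseteq> V" using facesD[of \<tau> 1] by auto
      then obtain v w where vw: "\<tau> = {v, w}" "v \<noteq> w" by (auto simp: card_2_iff)
      have "\<pi> v \<noteq> \<pi> w" using inj vw \<tau>(3) by (auto simp: inj_on_def)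
      then have "w \<in> bk v \<or> v \<in> bk w"
        using vw \<tau> by (auto simp: bk_def nbrs_def insert_commute)
      then show False using edges[of v] edges[of w] vw \<tau>(3) nz by (auto simp: insert_commute)
    qed
  qed
  have "s \<le> r \<Longrightarrow> z \<in> common_kernel {..<s} 2" for s
  proof (induction s)
    case (Suc s)
    then show ?case using step[of s] by (auto simp: common_kernel_def less_Suc_eq)
  qed (simp add: common_kernel_def z_chain)
  then show False using common_kernel_nonzero_faces[OF _ z_nz, of r 2] no by simp
qed

end

section \<open>Orders of small cost\<close>

text \<open>The order is built from the end; the average over all choices of the last vertex of the
  cost is the bound itself, as \<open>(b + 1) A(b) = f b + b A(b - 1)\<close> for the averages \<open>A\<close>.\<close>

lemma exists_averaging_order:
  fixes f :: "'a \<Rightarrow> nat \<Rightarrow> real"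
  assumes "finite R" and irr: "\<And>v. \<not> adj v v" and sym: "\<And>v w. adj v w \<Longrightarrow> adj w v"
  shows "\<exists>\<pi> :: 'a \<Rightarrow> nat. inj_on \<pi> R \<and> (\<Sum>v\<in>R. f v (card {w \<in> R. adj v w \<and> \<pi> w < \<pi> v}))
    \<le> (\<Sum>v\<in>R. (\<Sum>i\<le>card {w \<in> R. adj v w}. f v i) / (real (card {w \<in> R. adj v w}) + 1))"
  using assms(1)
proof (induction R rule: finite_psubset_induct)
  case (psubset R)
  define A where "A v b = (\<Sum>i\<le>b. f v i) / (real b + 1)" for v b
  define b where "b v = card {w \<in> R. adj v w}" for v
  define b' where "b' x v = card {w \<in> R - {x}. adj v w}" for x v
  have A_rec: "real b * A v (b - 1) + f v b = (real b + 1) * A v b" for v b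
    by (cases b) (auto simp: A_def field_simps)
  show ?case
  proof (cases "R = {}")
    case True
    then show ?thesis by simp
  next
    case False
    \<comment> \<open>The bound obtained when \<open>x\<close> is put last: all \<open>b x\<close>
      neighbours then precede \<open>x\<close>, and the induction hypothesis covers the other
      vertices.\<close>
    let ?g = "\<lambda>x. f x (b x) + (\<Sum>v\<in>R - {x}. A v (b' x v))"
    have b': "b' x v = (if adj v x then b v - 1 else b v)" if "x \<in> R" for x v
    proof -
      have "{w \<in> R - {x}. adj v w} = {w \<in> R. adj v w} - {x}" by auto
      then show ?thesis using that psubset.hyps by (simp add: b'_def b_def card_Diff_singleton_if)
    qed
    \<comment> \<open>For fixed \<open>v\<close>, the choices of \<open>x\<close> that lower its
      number of neighbours are its \<open>b v\<close> neighbours themselves.\<close>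
    have inner: "(\<Sum>x\<in>R - {v}. A v (b' x v)) = real (b v) * A v (b v - 1) + (real (card R) - 1 - real (b v)) * A v (b v)"
      if v: "v \<in> R" for v
    proof -
      let ?N = "{w \<in> R. adj v w}"
      have fin: "finite ?N" using psubset.hyps by simp
      have sub: "?N \<subseteq> R - {v}" using irr by auto
      have "(\<Sum>x\<in>R - {v}. A v (b' x v)) = (\<Sum>x\<in>?N. A v (b' x v)) + (\<Sum>x\<in>R - {v} - ?N. A v (b' x v))"
        using sum.subset_diff[OF sub] psubset.hyps by (simp add: add.commute)
      also have "(\<Sum>x\<in>?N. A v (b' x v)) = real (b v) * A v (b v - 1)"
        by (simp add: b' b_def)
      also have "(\<Sum>x\<in>R - {v} - ?N. A v (b' x v)) = real (card (R - {v} - ?N)) * A v (b v)"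
        by (simp add: b')
      also have "real (card (R - {v} - ?N)) = real (card R) - 1 - real (b v)"
      proof -
        have "card (R - {v} - ?N) + card ?N = card (R - {v})"
          using card_Diff_subset[OF fin sub] card_mono[OF _ sub] psubset.hyps by simp
        moreover have "card (R - {v}) + 1 = card R" using card_Suc_Diff1[OF psubset.hyps v] by simp
        ultimately show ?thesis by (simp add: b_def)
      qed
      finally show ?thesis .
    qed
    have "(\<Sum>x\<in>R. \<Sum>v\<in>R - {x}. A v (b' x v)) = (\<Sum>v\<in>R. \<Sum>x\<in>R - {v}. A v (b' x v))"
    proof -
      have "R - {x} = {v \<in> R. x \<noteq> v}" for x by auto
      then show ?thesis
        using sum.swap_restrict[of R R "\<lambda>x v. A v (b' x v)" "\<lambda>x v. x \<noteq> v"] psubset.hyps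
        by (simp add: neq_commute)
    qed
    also have "\<dots> = (\<Sum>v\<in>R. real (card R) * A v (b v) - f v (b v))"
    proof (intro sum.cong refl)
      fix v assume "v \<in> R"
      show "(\<Sum>x\<in>R - {v}. A v (b' x v)) = real (card R) * A v (b v) - f v (b v)"
        unfolding inner[OF \<open>v \<in> R\<close>] using A_rec[of "b v" v] by (simp add: algebra_simps)
    qed
    finally have "(\<Sum>x\<in>R. ?g x) = (\<Sum>x\<in>R. (\<Sum>v\<in>R. A v (b v)))"
      by (simp add: sum.distrib sum_subtractf sum_distrib_left)
    then obtain x where x: "x \<in> R" "?g x \<le> (\<Sum>v\<in>R. A v (b v))"
      using sum_strict_mono[OF psubset.hyps False, of "\<lambda>x. \<Sum>v\<in>R. A v (b v)" ?g] by force
    have "R - {x} \<subset> R" using x(1) by auto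
    from psubset.IH[OF this] obtain \<pi> :: "'a \<Rightarrow> nat" where "inj_on \<pi> (R - {x}) \<and>
      (\<Sum>v\<in>R - {x}. f v (card {w \<in> R - {x}. adj v w \<and> \<pi> w < \<pi> v})) \<le> (\<Sum>v\<in>R - {x}. A v (b' x v))"
      unfolding A_def b'_def by (rule exE)
    then have \<pi>: "inj_on \<pi> (R - {x})"
      "(\<Sum>v\<in>R - {x}. f v (card {w \<in> R - {x}. adj v w \<and> \<pi> w < \<pi> v})) \<le> (\<Sum>v\<in>R - {x}. A v (b' x v))"
      by auto
    define \<pi>' where "\<pi>' v = (if v = x then Suc (Max (insert 0 (\<pi> ` R))) else \<pi> v)" for v
    have less: "\<pi> v < \<pi>' x" if "v \<in> R" for v
      using that psubset.hyps by (auto simp: \<pi>'_def less_Suc_eq_le)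
    have "inj_on \<pi>' R"
      using \<pi>(1) less unfolding inj_on_def \<pi>'_def by (metis DiffI less_irrefl singletonD)
    moreover have "(\<Sum>v\<in>R. f v (card {w \<in> R. adj v w \<and> \<pi>' w < \<pi>' v})) \<le> (\<Sum>v\<in>R. A v (b v))"
    proof -
      have "{w \<in> R. adj x w \<and> \<pi>' w < \<pi>' x} = {w \<in> R. adj x w}"
        using less irr by (auto simp: \<pi>'_def) 
      moreover have "{w \<in> R. adj v w \<and> \<pi>' w < \<pi>' v} = {w \<in> R - {x}. adj v w \<and> \<pi> w < \<pi> v}" if "v \<in> R - {x}" for v
        using less[of v] that by (auto simp: \<pi>'_def)
      ultimately have "(\<Sum>v\<in>R. f v (card {w \<in> R. adj v w \<and> \<pi>' w < \<pi>' v}))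
          = f x (b x) + (\<Sum>v\<in>R - {x}. f v (card {w \<in> R - {x}. adj v w \<and> \<pi> w < \<pi> v}))"
        unfolding sum.remove[OF psubset.hyps x(1)] by (simp add: b_def)
      then show ?thesis using \<pi>(2) x(2) by simp
    qed
    ultimately show ?thesis unfolding A_def b_def by blast
  qed
qed

text \<open>For \<open>d \<ge> r\<close> the sum is \<open>r d - r (r + 1) / 2\<close>. For
  \<open>d < r\<close> it is \<open>d (d - 1) / 2\<close>, while the right-hand side equals
  \<open>d^2 / 2\<close>. Only terms of lower order are lost.\<close>

lemma back_cost_le:
  "real (\<Sum>s<r. d - Suc s) \<le> real r * real d - (real r)\<^sup>2 / 2 + (max 0 (real r - real d))\<^sup>2 / 2"
proof (induction r)
  case (Suc r)
  show ?case
  proof (cases "d \<le> r")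
    case True
    then have "real (\<Sum>s<Suc r. d - Suc s) = real (\<Sum>s<r. d - Suc s)" by simp
    also have "\<dots> \<le> real (Suc r) * real d - (real (Suc r))\<^sup>2 / 2 + (max 0 (real (Suc r) - real d))\<^sup>2 / 2"
      using Suc True by (simp add: max_def power2_eq_square field_simps split: if_splits)
    finally show ?thesis .
  next
    case False
    define S where "S = real (\<Sum>s<r. d - Suc s)"
    have d: "real d \<ge> real r + 1" using False by linarith
    have "real (\<Sum>s<Suc r. d - Suc s) = S + (real d - real r - 1)"
      using False by (simp add: S_def of_nat_diff)
    moreover have "S \<le> real r * real d - (real r)\<^sup>2 / 2"
      using Suc d by (simp add: S_def)
    ultimately show ?thesis
      using d by (simp add: power2_eq_square algebra_simps add_divide_distrib)
  qed
qed simp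

text \<open>The fraction is the integral of \<open>(max 0 (c - x))^2\<close> over
  \<open>[0, B]\<close>; each of the \<open>B\<close> terms of the Riemann sum exceeds its share by
  at most \<open>c\<close>.\<close>

lemma sum_pos_part_square_le:
  assumes "c \<ge> (0::real)"
  shows "(\<Sum>i<B. (max 0 (c - real i))\<^sup>2) \<le> (c ^ 3 - (max 0 (c - real B)) ^ 3) / 3 + real B * c"
proof (induction B)
  case 0
  then show ?case using assms by (simp add: max_def)
next
  case (Suc B)
  define x where "x = c - real B"
  have "(max 0 x)\<^sup>2 \<le> ((max 0 x) ^ 3 - (max 0 (x - 1)) ^ 3) / 3 + c"
  proof (cases "x \<le> 0")
    case True
    then show ?thesis using assms by (simp add: max_def)
  next
    case False
    have xc: "x \<le> c" by (simp add: x_def)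
    show ?thesis
    proof (cases "x \<le> 1")
      case True
      have "x * x \<le> x" using False True by (simp add: mult_left_le)
      moreover have "0 \<le> x ^ 3 / 3" using False by simp
      moreover have "max 0 (x - 1) = 0" "max 0 x = x" using False True by auto
      ultimately have "x * x \<le> x ^ 3 / 3 + c" "max 0 (x - 1) = 0" "max 0 x = x" using xc by linarith+
      then show ?thesis by (simp add: power2_eq_square)
    next
      case F: False
      have "x ^ 3 - (x - 1) ^ 3 = 3 * x\<^sup>2 - 3 * x + 1"
        by (simp add: power2_eq_square power3_eq_cube algebra_simps)
      then show ?thesis using F xc by (simp add: max_def field_simps)
    qed
  qed
  moreover have "c - real (Suc B) = x - 1" by (simp add: x_def)
  ultimately show ?case using Suc by (simp add: x_def algebra_simps diff_divide_distrib)
qed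

section \<open>The pointwise inequality\<close>

lemma affine_nonneg:
  fixes x :: real
  assumes "0 \<le> k * a + l" "0 \<le> k * b + l" "a \<le> x" "x \<le> b"
  shows "0 \<le> k * x + l"
proof (cases "k \<ge> 0")
  case True
  then show ?thesis using assms mult_left_mono[of a x k] by linarith
next
  case False
  then show ?thesis using assms mult_left_mono_neg[of x b k] by linarith
qed

text \<open>With \<open>n = r + H\<close> and \<open>\<kappa> = r / n\<close> this is \<open>n \<kappa>\<^sup>2 (3 - \<kappa>) / (1 + 2 \<kappa> - \<kappa>\<^sup>2)\<close>, the multiplier for which
  the sum of the pointwise inequalities below over all vertices is exactly the bound
  on the triangle density.\<close>

definition density_mult :: "real \<Rightarrow> real \<Rightarrow> real" where
  "density_mult r H = r\<^sup>2 * (3 * H + 2 * r) / (H\<^sup>2 + 4 * r * H + 2 * r\<^sup>2)"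

context
  fixes r H :: real
  assumes r0: "r \<ge> 0" and H0: "H \<ge> 0" and rH: "r + H > 0"
begin

lemma density_mult_denom: "H\<^sup>2 + 4 * r * H + 2 * r\<^sup>2 > 0"
proof (cases "r = 0")
  case True
  then show ?thesis using rH by simp
next
  case False
  then have "2 * r\<^sup>2 > 0" by simp
  moreover have "H\<^sup>2 \<ge> 0" "4 * r * H \<ge> 0" using r0 H0 by auto
  ultimately show ?thesis by linarith
qed

lemma density_mult_eq: "density_mult r H * (H\<^sup>2 + 4 * r * H + 2 * r\<^sup>2) = r\<^sup>2 * (3 * H + 2 * r)"
  using density_mult_denom by (simp add: density_mult_def)

lemma density_mult_nonneg: "density_mult r H \<ge> 0"
  unfolding density_mult_def using r0 H0 density_mult_denom by (intro divide_nonneg_pos) auto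

lemma density_mult_le: "density_mult r H \<le> r"
proof -
  have "r * (H\<^sup>2 + r * H) \<ge> 0" using r0 H0 by simp
  then have "r\<^sup>2 * (3 * H + 2 * r) \<le> r * (H\<^sup>2 + 4 * r * H + 2 * r\<^sup>2)"
    by (simp add: power2_eq_square algebra_simps)
  then show ?thesis using density_mult_denom by (simp add: density_mult_def pos_divide_le_eq)
qed

text \<open>Multiplied by the positive denominator, the difference of the sides is a sum of products
  of nonnegative factors. The bound serves at the corners with \<open>w = 0\<close> below, and for
  general \<open>M\<close> when \<open>w\<close> is negative.\<close>

lemma density_mult_ge:
  assumes "0 \<le> M" "M \<le> r"
  shows "2 * M\<^sup>2 \<le> density_mult r H * (2 * M + H)"
proof -
  let ?D = "H\<^sup>2 + 4 * r * H + 2 * r\<^sup>2"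
  have MM: "M * M \<le> r * r" using assms by (intro mult_mono) auto
  have "0 \<le> (r\<^sup>2 - M\<^sup>2) * (2 * H\<^sup>2) + (r - M) * (6 * r * M * H + 4 * r\<^sup>2 * M) + r\<^sup>2 * H\<^sup>2 + 2 * r * H * (r\<^sup>2 - M\<^sup>2)"
    using assms r0 H0 MM by (intro add_nonneg_nonneg mult_nonneg_nonneg) (auto simp: power2_eq_square)
  also have "\<dots> \<le> r\<^sup>2 * (3 * H + 2 * r) * (2 * M + H) - 2 * M\<^sup>2 * ?D"
  proof -
    have "r\<^sup>2 * (3 * H + 2 * r) * (2 * M + H) - 2 * M\<^sup>2 * ?D - ((r\<^sup>2 - M\<^sup>2) * (2 * H\<^sup>2) + (r - M) * (6 * r * M * H + 4 * r\<^sup>2 * M) + r\<^sup>2 * H\<^sup>2 + 2 * r * H * (r\<^sup>2 - M\<^sup>2)) = 0"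
      by (simp add: power2_eq_square algebra_simps)
    then show ?thesis by simp
  qed
  also have "r\<^sup>2 * (3 * H + 2 * r) * (2 * M + H) = density_mult r H * (2 * M + H) * ?D"
    unfolding density_mult_eq[symmetric] by (simp only: mult_ac)
  finally have "2 * M\<^sup>2 * ?D \<le> density_mult r H * (2 * M + H) * ?D"
    by linarith
  then show ?thesis using density_mult_denom by (simp add: mult_le_cancel_right)
qed

text \<open>The left-hand side is convex and the right-hand side affine in \<open>(M, w)\<close>, so it suffices to compare
  them at the vertices of the region \<open>0 \<le> w \<le> M\<close>, \<open>\<xi> \<le> M \<le> r\<close>.\<close>

lemma pointwise_nonneg_case:
  assumes \<xi>: "0 \<le> \<xi>" "\<xi> \<le> M" and M: "M \<le> r" and w: "0 \<le> w" "w \<le> M"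
  shows "(H + \<xi>) * (M\<^sup>2 + M * w + w\<^sup>2) \<le> \<xi> ^ 3 + density_mult r H * (\<xi> * H + (H + \<xi>) * (2 * (M - \<xi> + w + H / 2)))"
proof -
  let ?C = "density_mult r H" and ?N = "H + \<xi>"
  have \<xi>r: "\<xi> \<le> r" using \<xi> M by simp
  have C0: "?C \<ge> 0" by (rule density_mult_nonneg)
  \<comment> \<open>\<open>v1\<close> to \<open>v4\<close> treat \<open>(M, w)\<close> at
    \<open>(\<xi>, 0)\<close>, \<open>(r, 0)\<close>, \<open>(\<xi>, \<xi>)\<close> and
    \<open>(r, r)\<close>.\<close>
  have v1: "0 \<le> ?C * (\<xi> * H + ?N * H) + \<xi> ^ 3 - ?N * \<xi>\<^sup>2"
  proof -
    have "0 \<le> H * (?C * (2 * \<xi> + H) - \<xi>\<^sup>2)"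
      using density_mult_ge[OF \<xi>(1) \<xi>r] H0 zero_le_power2[of \<xi>] by (intro mult_nonneg_nonneg) linarith+
    then show ?thesis by (simp add: power2_eq_square power3_eq_cube algebra_simps)
  qed
  have v2: "0 \<le> ?C * (\<xi> * H + ?N * (2 * r - 2 * \<xi> + H)) + \<xi> ^ 3 - ?N * r\<^sup>2"
  proof -
    have "0 \<le> H * (?C * (2 * r + H) - 2 * r\<^sup>2)"
      using density_mult_ge[OF r0 order_refl] H0 by (intro mult_nonneg_nonneg) auto
    moreover have "0 \<le> \<xi> * (r - \<xi>) * (2 * ?C - r - \<xi>) + r\<^sup>2 * H"
    proof -
      define t where "t = \<xi> * (r - \<xi>)"
      have t: "0 \<le> t" "t \<le> r * r"
        unfolding t_def using \<xi> \<xi>r by (auto intro!: mult_mono)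
      have pos: "2 * r + H > 0" using r0 H0 rH by linarith
      have "(r + \<xi>) * (2 * r + H) \<le> (2 * r) * (2 * r + H)"
        using \<xi>r pos by (intro mult_right_mono) auto
      then have "- (2 * r * H) \<le> (2 * ?C - r - \<xi>) * (2 * r + H)"
        using density_mult_ge[OF r0 order_refl] by (simp add: power2_eq_square algebra_simps)
      then have "t * (- (2 * r * H)) \<le> t * ((2 * ?C - r - \<xi>) * (2 * r + H))"
        using t(1) by (intro mult_left_mono) auto
      moreover have "t * (2 * r * H) \<le> r * r * (2 * r * H)"
        using t r0 H0 by (intro mult_right_mono) auto
      moreover have "0 \<le> r * r * (H * H)" using r0 H0 by simp
      ultimately have "0 \<le> (t * (2 * ?C - r - \<xi>) + r\<^sup>2 * H) * (2 * r + H)"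
        by (simp add: power2_eq_square algebra_simps)
      then show ?thesis using pos by (simp add: t_def zero_le_mult_iff)
    qed
    ultimately have "0 \<le> H * (?C * (2 * r + H) - 2 * r\<^sup>2) + (\<xi> * (r - \<xi>) * (2 * ?C - r - \<xi>) + r\<^sup>2 * H)"
      by linarith
    then show ?thesis by (simp add: power2_eq_square power3_eq_cube algebra_simps)
  qed
  have v3: "0 \<le> ?C * (\<xi> * H + ?N * (2 * \<xi> + H)) + \<xi> ^ 3 - 3 * ?N * \<xi>\<^sup>2"
  proof -
    let ?D = "H\<^sup>2 + 4 * r * H + 2 * r\<^sup>2"
    have "\<xi> * \<xi> \<le> r * r" "\<xi> * \<xi> * \<xi> \<le> r * r * r" using \<xi> \<xi>r r0 by (auto intro!: mult_mono)
    then have "\<xi> * (3 * H + 2 * \<xi>) \<le> r * (3 * H + 2 * r)" "\<xi>\<^sup>2 * (3 * H + 2 * \<xi>) \<le> r\<^sup>2 * (3 * H + 2 * r)"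
      using \<xi> \<xi>r r0 H0 unfolding power2_eq_square by (auto intro!: mult_mono)
    then have "0 \<le> H\<^sup>2 * (r\<^sup>2 * (3 * H + 2 * r) - \<xi>\<^sup>2 * (3 * H + 2 * \<xi>))
        + 4 * r * \<xi> * H * (r * (3 * H + 2 * r) - \<xi> * (3 * H + 2 * \<xi>)) + 4 * r\<^sup>2 * \<xi>\<^sup>2 * (r - \<xi>)"
      using r0 H0 \<xi> \<xi>r by (intro add_nonneg_nonneg mult_nonneg_nonneg) auto
    also have "\<dots> = r\<^sup>2 * (3 * H + 2 * r) * (H\<^sup>2 + 4 * \<xi> * H + 2 * \<xi>\<^sup>2) - \<xi>\<^sup>2 * (3 * H + 2 * \<xi>) * ?D"
      by (simp add: power2_eq_square algebra_simps)
    also have "\<dots> = (?C * (H\<^sup>2 + 4 * \<xi> * H + 2 * \<xi>\<^sup>2) - \<xi>\<^sup>2 * (3 * H + 2 * \<xi>)) * ?D"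
    proof -
      have "k * D * E - y * D = (k * E - y) * D" for k D E y :: real by (simp add: algebra_simps)
      then show ?thesis unfolding density_mult_eq[symmetric] .
    qed
    finally have "0 \<le> ?C * (H\<^sup>2 + 4 * \<xi> * H + 2 * \<xi>\<^sup>2) - \<xi>\<^sup>2 * (3 * H + 2 * \<xi>)"
      using density_mult_denom by (simp add: zero_le_mult_iff)
    then show ?thesis by (simp add: power2_eq_square power3_eq_cube algebra_simps)
  qed
  \<comment> \<open>By \<open>density_mult_eq\<close> the slack at this corner is exactly
    \<open>(r - \<xi>)^2 * (2 * r + \<xi> - 2 * ?C)\<close>, so equality holds at
    \<open>\<xi> = r\<close>.\<close>
  have v4: "0 \<le> ?C * (\<xi> * H + ?N * (4 * r - 2 * \<xi> + H)) + \<xi> ^ 3 - 3 * ?N * r\<^sup>2"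
  proof -
    have "0 \<le> (r - \<xi>)\<^sup>2 * (2 * r + \<xi> - 2 * ?C)"
      using density_mult_le \<xi>(1) by (intro mult_nonneg_nonneg) auto
    also have "\<dots> = ?C * (\<xi> * H + ?N * (4 * r - 2 * \<xi> + H)) + \<xi> ^ 3 - 3 * ?N * r\<^sup>2
        + (r\<^sup>2 * (3 * H + 2 * r) - ?C * (H\<^sup>2 + 4 * r * H + 2 * r\<^sup>2))"
      by (simp add: power2_eq_square power3_eq_cube algebra_simps)
    finally show ?thesis using density_mult_eq by simp
  qed
  \<comment> \<open>Replacing \<open>M^2\<close> by its chord between \<open>\<xi>\<close> and
    \<open>r\<close> makes the inequality affine in \<open>M\<close> and loses nothing at the two
    ends. At the end of the proof \<open>w^2\<close> is treated alike between 0 and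
    \<open>M\<close>.\<close>
  have chord: "M\<^sup>2 \<le> (\<xi> + r) * M - \<xi> * r"
  proof -
    have "0 \<le> (M - \<xi>) * (r - M)" using \<xi> M by simp
    then show ?thesis by (simp add: power2_eq_square algebra_simps)
  qed
  have w_0: "0 \<le> ?C * (\<xi> * H + ?N * (2 * M - 2 * \<xi> + H)) + \<xi> ^ 3 - ?N * M\<^sup>2"
  proof -
    have "0 \<le> (2 * ?C * ?N - ?N * (\<xi> + r)) * M + (?C * (\<xi> * H + ?N * (H - 2 * \<xi>)) + \<xi> ^ 3 + ?N * (\<xi> * r))"
      by (rule affine_nonneg[OF _ _ \<xi>(2) M])
        (use v1 v2 in \<open>simp_all add: power2_eq_square algebra_simps\<close>)
    also have "\<dots> \<le> ?C * (\<xi> * H + ?N * (2 * M - 2 * \<xi> + H)) + \<xi> ^ 3 - ?N * M\<^sup>2"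
      using mult_left_mono[OF chord, of ?N] H0 \<xi>(1) by (simp add: algebra_simps)
    finally show ?thesis .
  qed
  have w_M: "0 \<le> ?C * (\<xi> * H + ?N * (4 * M - 2 * \<xi> + H)) + \<xi> ^ 3 - 3 * ?N * M\<^sup>2"
  proof -
    have "0 \<le> (4 * ?C * ?N - 3 * ?N * (\<xi> + r)) * M + (?C * (\<xi> * H + ?N * (H - 2 * \<xi>)) + \<xi> ^ 3 + 3 * ?N * (\<xi> * r))"
      by (rule affine_nonneg[OF _ _ \<xi>(2) M])
        (use v3 v4 in \<open>simp_all add: power2_eq_square algebra_simps\<close>)
    also have "\<dots> \<le> ?C * (\<xi> * H + ?N * (4 * M - 2 * \<xi> + H)) + \<xi> ^ 3 - 3 * ?N * M\<^sup>2"
      using mult_left_mono[OF chord, of ?N] H0 \<xi>(1) by (simp add: algebra_simps)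
    finally show ?thesis .
  qed
  have "0 \<le> (2 * ?C * ?N - 2 * ?N * M) * w + (?C * (\<xi> * H + ?N * (2 * M - 2 * \<xi> + H)) + \<xi> ^ 3 - ?N * M\<^sup>2)"
    by (rule affine_nonneg[OF _ _ w])
      (use w_0 w_M in \<open>simp_all add: power2_eq_square algebra_simps\<close>)
  moreover have "?N * w\<^sup>2 \<le> ?N * (M * w)"
    using w H0 \<xi>(1) by (intro mult_left_mono) (auto simp: power2_eq_square intro: mult_right_mono)
  ultimately show ?thesis by (simp add: algebra_simps)
qed

text \<open>This is the case \<open>w = - v\<close>. It suffices to prove the bound with the
  multiplier \<open>B\<close>, which \<open>density_mult_ge\<close> places below
  \<open>density_mult r H\<close>.\<close>

lemma pointwise_neg_case:
  assumes \<xi>: "0 \<le> \<xi>" "\<xi> \<le> M" and M: "M \<le> r" and v: "0 < v" "v \<le> H / 2"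
  shows "(H + \<xi>) * (M ^ 3 / (M + v)) \<le> \<xi> ^ 3 + density_mult r H * (\<xi> * H + (H + \<xi>) * (2 * (M - \<xi> - v + H / 2)))"
proof -
  let ?C = "density_mult r H" and ?N = "H + \<xi>"
  define B where "B = 2 * M\<^sup>2 / (2 * M + H)"
  define q where "q = M - \<xi> - v + H / 2"
  have M0: "0 \<le> M" using \<xi> by simp
  have H: "0 < H" using v by simp
  have q: "M - \<xi> \<le> q" "0 \<le> q" using v \<xi> by (auto simp: q_def)
  have B0: "0 \<le> B" using M0 H by (simp add: B_def)
  have B_le_M: "B \<le> M" using M0 H by (simp add: B_def divide_simps power2_eq_square algebra_simps)
  have B_le_C: "B \<le> ?C" using density_mult_ge[OF M0 M] M0 H by (simp add: B_def divide_simps)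
  \<comment> \<open>\<open>B * (\<xi> + q)\<close> is the chord of the convex function
    \<open>v \<mapsto> M^3 / (M + v)\<close> between \<open>v = 0\<close> and
    \<open>v = H / 2\<close>.\<close>
  have step1: "M ^ 3 / (M + v) \<le> B * (\<xi> + q)"
  proof -
    have "0 \<le> 2 * M\<^sup>2 * (v * (H / 2 - v))" using v M0 by simp
    then have "M ^ 3 * (2 * M + H) \<le> 2 * M\<^sup>2 * (M + H / 2 - v) * (M + v)"
      by (simp add: power2_eq_square power3_eq_cube algebra_simps)
    then have "M ^ 3 / (M + v) \<le> 2 * M\<^sup>2 * (M + H / 2 - v) / (2 * M + H)"
      using M0 v H by (simp add: divide_simps)
    then show ?thesis by (simp add: B_def q_def algebra_simps)
  qed
  have step2: "B * (\<xi>\<^sup>2 - q * ?N) \<le> \<xi> ^ 3"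
  proof (cases "\<xi>\<^sup>2 \<le> q * ?N")
    case True
    then have "B * (\<xi>\<^sup>2 - q * ?N) \<le> 0" using B0 by (intro mult_nonneg_nonpos) auto
    also have "0 \<le> \<xi> ^ 3" using \<xi> by simp
    finally show ?thesis .
  next
    case False
    have "B * (\<xi>\<^sup>2 - q * ?N) \<le> (\<xi> + q) * (\<xi>\<^sup>2 - q * ?N)"
      using False B_le_M q by (intro mult_right_mono) auto
    also have "\<dots> = \<xi> ^ 3 - q * (\<xi> * H + q * ?N)"
      by (simp add: power2_eq_square power3_eq_cube algebra_simps)
    also have "\<dots> \<le> \<xi> ^ 3" using q \<xi> H by simp
    finally show ?thesis .
  qed
  have "?N * (M ^ 3 / (M + v)) \<le> ?N * (B * (\<xi> + q))"
    using step1 H \<xi> by (intro mult_left_mono) auto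
  also have "\<dots> \<le> \<xi> ^ 3 + B * (\<xi> * H + ?N * (2 * q))"
    using step2 by (simp add: power2_eq_square algebra_simps)
  also have "\<dots> \<le> \<xi> ^ 3 + ?C * (\<xi> * H + ?N * (2 * q))"
    using B_le_C \<xi> H q by (intro add_left_mono mult_right_mono) auto
  finally show ?thesis by (simp add: q_def)
qed

text \<open>The form used for a vertex outside the initial clique, with \<open>M = r - a\<close>,
  \<open>w = M - (b + 1)\<close> and \<open>\<xi> = r - k\<close>. The divisor
  \<open>H + \<xi> = n - k\<close> is the number of such vertices, so these quotients add up to
  \<open>\<xi>^3\<close> and \<open>\<xi> * H\<close>.\<close>

lemma pointwise_bound:
  assumes \<xi>: "0 \<le> \<xi>" "\<xi> \<le> M" and M: "M \<le> r" and w: "- H / 2 \<le> w" "w < M" and N: "0 < H + \<xi>"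
  shows "(M ^ 3 - (max 0 w) ^ 3) / (M - w)
    \<le> \<xi> ^ 3 / (H + \<xi>) + density_mult r H * (\<xi> * H / (H + \<xi>) + 2 * (M - \<xi> + w + H / 2))"
proof -
  let ?L = "(M ^ 3 - (max 0 w) ^ 3) / (M - w)"
  have "(H + \<xi>) * ?L \<le> \<xi> ^ 3 + density_mult r H * (\<xi> * H + (H + \<xi>) * (2 * (M - \<xi> + w + H / 2)))"
  proof (cases "w \<ge> 0")
    case True
    have "M ^ 3 - w ^ 3 = (M\<^sup>2 + M * w + w\<^sup>2) * (M - w)"
      by (simp add: power2_eq_square power3_eq_cube algebra_simps)
    then have "?L = M\<^sup>2 + M * w + w\<^sup>2" using True w by (simp add: max_def)
    then show ?thesis using pointwise_nonneg_case[OF \<xi> M True] w by simp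
  next
    case False
    then show ?thesis using pointwise_neg_case[OF \<xi> M, of "- w"] w by simp
  qed
  then have "?L \<le> (\<xi> ^ 3 + density_mult r H * (\<xi> * H + (H + \<xi>) * (2 * (M - \<xi> + w + H / 2)))) / (H + \<xi>)"
    using N by (simp add: pos_le_divide_eq mult.commute)
  also have "\<dots> = \<xi> ^ 3 / (H + \<xi>) + density_mult r H * (\<xi> * H / (H + \<xi>) + 2 * (M - \<xi> + w + H / 2))"
  proof -
    have "(a + c * (b + d * q)) / d = a / d + c * (b / d + q)" if "d > 0" for a b c d q :: real
      using that by (simp add: field_simps)
    then show ?thesis using N .
  qed
  finally show ?thesis .
qed

end

section \<open>Triangles in graphs without induced 4-cycles\<close>

locale c4_graph =
  fixes V :: "'a set" and adj :: "'a \<Rightarrow> 'a \<Rightarrow> bool" and r :: nat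
  assumes finV: "finite V"
    and irr: "\<not> adj v v"
    and sym: "adj v w \<Longrightarrow> adj w v"
    and r_le: "r \<le> card V"
    and cliques: "K \<subseteq> V \<Longrightarrow> (\<And>u v. u \<in> K \<Longrightarrow> v \<in> K \<Longrightarrow> u \<noteq> v \<Longrightarrow> adj u v) \<Longrightarrow> card K \<le> r"
    and no_C4: "u \<in> V \<Longrightarrow> v \<in> V \<Longrightarrow> u \<noteq> v \<Longrightarrow> \<not> adj u v \<Longrightarrow> w \<in> V \<Longrightarrow> w' \<in> V \<Longrightarrow> w \<noteq> w' \<Longrightarrow>
      adj u w \<Longrightarrow> adj v w \<Longrightarrow> adj u w' \<Longrightarrow> adj v w' \<Longrightarrow> adj w w'"
begin

definition deg :: "'a \<Rightarrow> real" where
  "deg v = real (card {w \<in> V. adj v w})"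

abbreviation n :: real where "n \<equiv> real (card V)"

abbreviation R :: real where "R \<equiv> real r"

text \<open>By \<open>no_C4\<close> the common neighbours are pairwise adjacent.\<close>

lemma codeg_le:
  assumes "u \<in> V" "v \<in> V" "u \<noteq> v" "\<not> adj u v"
  shows "card {w \<in> V. adj u w \<and> adj v w} \<le> r"
proof (rule cliques)
  fix w w' assume "w \<in> {w \<in> V. adj u w \<and> adj v w}" "w' \<in> {w \<in> V. adj u w \<and> adj v w}" "w \<noteq> w'"
  then show "adj w w'" using no_C4[OF assms, of w w'] by blast
qed auto

text \<open>Inclusion-exclusion: both neighbourhoods avoid \<open>u\<close> and \<open>v\<close>,
  and they share at most \<open>r\<close> vertices.\<close>

lemma deg_add_le:
  assumes uv: "u \<in> V" "v \<in> V" "u \<noteq> v" "\<not> adj u v"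
  shows "deg u + deg v \<le> n - 2 + R"
proof -
  let ?A = "{w \<in> V. adj u w}" and ?B = "{w \<in> V. adj v w}"
  have "?A \<inter> ?B = {w \<in> V. adj u w \<and> adj v w}" by auto
  then have "card (?A \<inter> ?B) \<le> r" using codeg_le[OF uv] by simp
  moreover have "card (?A \<union> ?B) \<le> card (V - {u, v})"
    using finV irr uv sym by (intro card_mono) auto
  moreover have "card (V - {u, v}) + 2 = card V"
  proof -
    have "card {u, v} = 2" "{u, v} \<subseteq> V" using uv by auto
    then show ?thesis using card_mono[OF finV, of "{u, v}"] by (simp add: card_Diff_subset)
  qed
  moreover have "card ?A + card ?B = card (?A \<union> ?B) + card (?A \<inter> ?B)"
    using finV by (intro card_Un_Int) auto
  ultimately have "card ?A + card ?B + 2 \<le> card V + r" by linarith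
  then show ?thesis unfolding deg_def by linarith
qed

text \<open>Non-adjacent vertices have at least \<open>n - r\<close> non-neighbours in total, so the set \<open>K\<close> of
  vertices with fewer than \<open>(n - r) / 2\<close> non-neighbours is a clique. It comes first in the order; the
  neighbours in \<open>K\<close> of a vertex outside are its \<open>a\<close> certain predecessors, and a random number of
  its \<open>b\<close> other neighbours is added to them.\<close>

lemma triangle_upper_bound:
  assumes order_bound: "\<And>\<pi> :: 'a \<Rightarrow> nat. inj_on \<pi> V \<Longrightarrow>
      t \<le> (\<Sum>v\<in>V. \<Sum>s<r. card {w \<in> V. adj v w \<and> \<pi> w < \<pi> v} - Suc s)"
    and ne: "V \<noteq> {}"
  shows "6 * real t \<le> R * (\<Sum>v\<in>V. deg v) * (3 * n\<^sup>2 - R\<^sup>2) / (n\<^sup>2 + 2 * R * n - R\<^sup>2) + 6 * n\<^sup>2"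
proof -
  define S where "S = (\<Sum>v\<in>V. deg v)"
  define P where "P x = R * x - R\<^sup>2 / 2 + (max 0 (R - x))\<^sup>2 / 2" for x
  define K where "K = {v \<in> V. 2 * (n - 1 - deg v) < n - R}"
  define W where "W = V - K"
  define k where "k = card K"
  define a where "a v = card {w \<in> K. adj v w}" for v
  define b where "b v = card {w \<in> W. adj v w}" for v
  define A where "A v = (\<Sum>i\<le>b v. P (real (a v + i))) / (real (b v) + 1)" for v
  have n_pos: "n > 0" using finV ne by (simp add: card_gt_0_iff)
  have Rn: "R \<le> n" using r_le by simp
  have fin: "finite K" "finite W" and V_eq: "V = K \<union> W" and disj: "K \<inter> W = {}" and KV: "K \<subseteq> V"
    using finV by (auto simp: K_def W_def)
  have K_clique: "adj u v" if "u \<in> K" "v \<in> K" "u \<noteq> v" for u v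
  proof (rule ccontr)
    assume "\<not> adj u v"
    then have "deg u + deg v \<le> n - 2 + R" using that KV by (intro deg_add_le) auto
    then show False using that by (simp add: K_def)
  qed
  have kr: "k \<le> r" unfolding k_def by (rule cliques[OF KV K_clique])
  have deg_ab: "deg v = real (a v) + real (b v)" for v
  proof -
    have "{w \<in> V. adj v w} = {w \<in> K. adj v w} \<union> {w \<in> W. adj v w}" using V_eq by auto
    then have "card {w \<in> V. adj v w} = a v + b v"
      unfolding a_def b_def using fin disj by (simp add: card_Un_disjoint disjoint_iff)
    then show ?thesis by (simp add: deg_def)
  qed
  have W_card: "real (card W) = n - real k"
    unfolding W_def k_def using KV fin card_mono[OF finV KV] by (simp add: card_Diff_subset of_nat_diff)
  have ak: "a v \<le> k" for v unfolding a_def k_def using fin by (intro card_mono) auto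
  obtain h where h: "bij_betw h K {0..<k}"
    using ex_bij_betw_finite_nat[OF fin(1)] unfolding k_def by blast
  obtain \<pi>1 :: "'a \<Rightarrow> nat" where \<pi>1: "inj_on \<pi>1 W \<and>
    (\<Sum>v\<in>W. P (real (a v + card {w \<in> W. adj v w \<and> \<pi>1 w < \<pi>1 v}))) \<le> (\<Sum>v\<in>W. A v)"
    using exists_averaging_order[OF fin(2), of adj "\<lambda>v i. P (real (a v + i))"] irr sym
    unfolding A_def b_def by blast
  define \<pi> where "\<pi> v = (if v \<in> K then h v else k + \<pi>1 v)" for v
  have h_less: "h v < k" if "v \<in> K" for v using h that by (auto simp: bij_betw_def)
  have "inj_on \<pi> V"
  proof (rule inj_onI)
    fix u v assume uv: "u \<in> V" "v \<in> V" "\<pi> u = \<pi> v"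
    have "u \<in> K \<longleftrightarrow> v \<in> K" using uv h_less[of u] h_less[of v] by (auto simp: \<pi>_def split: if_splits)
    then show "u = v"
      using uv h \<pi>1 unfolding \<pi>_def W_def by (auto simp: bij_betw_def inj_on_def split: if_splits)
  qed
  then have "real t \<le> real (\<Sum>v\<in>V. \<Sum>s<r. card {w \<in> V. adj v w \<and> \<pi> w < \<pi> v} - Suc s)"
    using order_bound of_nat_le_iff by blast
  also have "\<dots> = (\<Sum>v\<in>V. real (\<Sum>s<r. card {w \<in> V. adj v w \<and> \<pi> w < \<pi> v} - Suc s))"
    by simp
  also have "\<dots> \<le> (\<Sum>v\<in>V. P (real (card {w \<in> V. adj v w \<and> \<pi> w < \<pi> v})))"
    unfolding P_def by (intro sum_mono back_cost_le)
  also have "\<dots> = (\<Sum>v\<in>K. P (real (card {w \<in> V. adj v w \<and> \<pi> w < \<pi> v})))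
      + (\<Sum>v\<in>W. P (real (card {w \<in> V. adj v w \<and> \<pi> w < \<pi> v})))"
    using fin disj unfolding V_eq by (intro sum.union_disjoint) auto
  also have "(\<Sum>v\<in>K. P (real (card {w \<in> V. adj v w \<and> \<pi> w < \<pi> v}))) = (\<Sum>v\<in>K. P (real (h v)))"
  proof (intro sum.cong refl)
    fix v assume v: "v \<in> K"
    have "{w \<in> V. adj v w \<and> \<pi> w < \<pi> v} = {w \<in> K. h w < h v}"
      using v KV K_clique h_less[OF v] by (auto simp: \<pi>_def)
    moreover have "h ` {w \<in> K. h w < h v} = {0..<h v}"
    proof (intro subset_antisym subsetI)
      fix j assume j: "j \<in> {0..<h v}"
      then have "j \<in> h ` K" using h h_less[OF v] by (auto simp: bij_betw_def)
      then show "j \<in> h ` {w \<in> K. h w < h v}" using j by auto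
    qed auto
    moreover have "inj_on h {w \<in> K. h w < h v}"
      using h by (auto simp: bij_betw_def inj_on_def)
    ultimately have "card {w \<in> V. adj v w \<and> \<pi> w < \<pi> v} = h v"
      by (metis card_atLeastLessThan card_image diff_zero)
    then show "P (real (card {w \<in> V. adj v w \<and> \<pi> w < \<pi> v})) = P (real (h v))" by simp
  qed
  also have "\<dots> = (\<Sum>j<k. P (real j))"
    using sum.reindex_bij_betw[OF h, of "\<lambda>j. P (real j)"] by (simp add: atLeast0LessThan)
  also have "(\<Sum>v\<in>W. P (real (card {w \<in> V. adj v w \<and> \<pi> w < \<pi> v})))
      = (\<Sum>v\<in>W. P (real (a v + card {w \<in> W. adj v w \<and> \<pi>1 w < \<pi>1 v})))"
  proof (intro sum.cong refl)
    fix v assume v: "v \<in> W"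
    then have "v \<notin> K" by (simp add: W_def)
    then have "{w \<in> V. adj v w \<and> \<pi> w < \<pi> v} = {w \<in> K. adj v w} \<union> {w \<in> W. adj v w \<and> \<pi>1 w < \<pi>1 v}"
      using V_eq disj h_less by (auto simp: \<pi>_def intro: trans_less_add1)
    moreover have "card ({w \<in> K. adj v w} \<union> {w \<in> W. adj v w \<and> \<pi>1 w < \<pi>1 v})
        = a v + card {w \<in> W. adj v w \<and> \<pi>1 w < \<pi>1 v}"
      unfolding a_def using fin disj by (intro card_Un_disjoint) auto
    ultimately show "P (real (card {w \<in> V. adj v w \<and> \<pi> w < \<pi> v}))
      = P (real (a v + card {w \<in> W. adj v w \<and> \<pi>1 w < \<pi>1 v}))" by simp
  qed
  also have "\<dots> \<le> (\<Sum>v\<in>W. A v)" using \<pi>1 by blast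
  finally have t_le: "real t \<le> (\<Sum>j<k. P (real j)) + (\<Sum>v\<in>W. A v)" by simp
  \<comment> \<open>For \<open>j \<le> R\<close> the definition of \<open>P\<close> simplifies to
    \<open>j^2 / 2\<close>.\<close>
  have "6 * (\<Sum>j<j'. P (real j)) \<le> real j' ^ 3" if "j' \<le> k" for j'
    using that
  proof (induction j')
    case (Suc j')
    have "max 0 (R - real j') = R - real j'" using Suc.prems kr by auto
    then have "6 * P (real j') = 3 * (real j')\<^sup>2"
      by (simp add: P_def power2_eq_square algebra_simps add_divide_distrib diff_divide_distrib)
    moreover have "real (Suc j') ^ 3 = real j' ^ 3 + 3 * (real j')\<^sup>2 + 3 * real j' + 1"
      by (simp add: power2_eq_square power3_eq_cube algebra_simps)
    ultimately show ?case using Suc by simp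
  qed simp
  then have K_sum: "6 * (\<Sum>j<k. P (real j)) \<le> real k ^ 3" by simp
  define \<xi> where "\<xi> = R - real k"
  define H where "H = n - R"
  define C where "C = density_mult R H"
  define N where "N = H + \<xi>"
  have N_eq: "N = n - real k" by (simp add: N_def H_def \<xi>_def)
  have \<xi>0: "0 \<le> \<xi>" and H0: "0 \<le> H" and RH: "R + H > 0" using kr Rn n_pos by (auto simp: \<xi>_def H_def)
  have C0: "0 \<le> C" unfolding C_def using H0 RH by (intro density_mult_nonneg) auto
  have A_le: "6 * A v \<le> 6 * R * real (a v) + 3 * R * real (b v) - 3 * R\<^sup>2 + 3 * R + (\<xi> ^ 3 / N
      + C * (\<xi> * H / N + 2 * (real k - real (a v) + (n - 1 - real (a v) - real (b v)) - H / 2)))" if v: "v \<in> W" for v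
  proof -
    define c where "c = R - real (a v)"
    define B where "B = real (b v) + 1"
    have B: "B > 0" by (simp add: B_def)
    have c: "\<xi> \<le> c" "c \<le> R" using ak[of v] by (auto simp: c_def \<xi>_def)
    have vV: "v \<in> V" "\<not> 2 * (n - 1 - deg v) < n - R" using v by (auto simp: W_def K_def)
    have N: "N > 0"
      using v fin W_card N_eq by (metis card_gt_0_iff empty_iff of_nat_0_less_iff)
    have "(\<Sum>i\<le>b v. P (real (a v + i)))
        = (\<Sum>i\<le>b v. R * real (a v) - R\<^sup>2 / 2) + R * (\<Sum>i\<le>b v. real i) + (\<Sum>i\<le>b v. (max 0 (c - real i))\<^sup>2) / 2"
      by (simp add: P_def c_def algebra_simps sum.distrib sum_subtractf sum_distrib_left sum_divide_distrib)
    also have "(\<Sum>i\<le>b v. real i) = real (b v) * B / 2"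
    proof -
      have "(\<Sum>i\<le>m. real i) = real m * (real m + 1) / 2" for m
        by (induction m) (auto simp: field_simps)
      then show ?thesis by (simp add: B_def)
    qed
    also have "(\<Sum>i\<le>b v. R * real (a v) - R\<^sup>2 / 2) = B * (R * real (a v) - R\<^sup>2 / 2)"
      by (simp add: B_def algebra_simps)
    finally have eq: "(\<Sum>i\<le>b v. P (real (a v + i)))
        = B * (R * real (a v) - R\<^sup>2 / 2) + R * (real (b v) * B / 2) + (\<Sum>i\<le>b v. (max 0 (c - real i))\<^sup>2) / 2" .
    have "(\<Sum>i\<le>b v. (max 0 (c - real i))\<^sup>2) \<le> (c ^ 3 - (max 0 (c - B)) ^ 3) / 3 + B * c"
      using sum_pos_part_square_le[of c "Suc (b v)"] \<xi>0 c by (simp add: lessThan_Suc_atMost B_def add.commute)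
    then have "6 * (\<Sum>i\<le>b v. P (real (a v + i)))
        \<le> B * (6 * R * real (a v) - 3 * R\<^sup>2) + 3 * R * real (b v) * B + (c ^ 3 - (max 0 (c - B)) ^ 3) + 3 * B * c"
      unfolding eq by (simp add: algebra_simps diff_divide_distrib)
    then have "6 * A v \<le> (B * (6 * R * real (a v) - 3 * R\<^sup>2) + 3 * R * real (b v) * B + (c ^ 3 - (max 0 (c - B)) ^ 3) + 3 * B * c) / B"
      unfolding A_def using B by (simp add: B_def divide_right_mono)
    also have "\<dots> = 6 * R * real (a v) - 3 * R\<^sup>2 + 3 * R * real (b v) + (c ^ 3 - (max 0 (c - B)) ^ 3) / B + 3 * c"
      using B by (simp add: field_simps)
    also have "(c ^ 3 - (max 0 (c - B)) ^ 3) / B = (c ^ 3 - (max 0 (c - B)) ^ 3) / (c - (c - B))" by simp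
    \<comment> \<open>Here \<open>w = c - B = R - 1 - deg v\<close>, and the requirement
      \<open>- H / 2 \<le> w\<close> says exactly that \<open>v\<close> is not in
      \<open>K\<close>.\<close>
    also have "\<dots> \<le> \<xi> ^ 3 / N + C * (\<xi> * H / N + 2 * (c - \<xi> + (c - B) + H / 2))"
      unfolding N_def C_def
      by (rule pointwise_bound)
        (use RH H0 \<xi>0 c B N vV in \<open>auto simp: N_def c_def B_def H_def deg_ab\<close>)
    also have "c - \<xi> + (c - B) + H / 2 = real k - real (a v) + (n - 1 - real (a v) - real (b v)) - H / 2"
      by (simp add: c_def B_def H_def \<xi>_def field_simps)
    finally show ?thesis using c(2) by linarith
  qed
  define \<alpha> where "\<alpha> = (\<Sum>v\<in>W. real (a v))"
  define \<beta> where "\<beta> = (\<Sum>v\<in>W. real (b v))"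
  \<comment> \<open>Edges between \<open>K\<close> and \<open>W\<close> are counted from both ends,
    whence \<open>2 * \<alpha>\<close>; \<open>\<beta>\<close> collects the degrees inside
    \<open>W\<close>.\<close>
  have S_eq: "S = real k * (real k - 1) + 2 * \<alpha> + \<beta>"
  proof -
    have "S = (\<Sum>v\<in>K. deg v) + (\<Sum>v\<in>W. deg v)"
      unfolding S_def V_eq using fin disj by (intro sum.union_disjoint) auto
    moreover have "(\<Sum>v\<in>W. deg v) = \<alpha> + \<beta>"
      by (simp add: deg_ab \<alpha>_def \<beta>_def sum.distrib)
    moreover have "(\<Sum>v\<in>K. deg v) = (\<Sum>v\<in>K. real (a v)) + (\<Sum>v\<in>K. real (b v))"
      by (simp add: deg_ab sum.distrib)
    moreover have "(\<Sum>v\<in>K. real (a v)) = real k * (real k - 1)"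
    proof -
      have "real (a v) = real k - 1" if "v \<in> K" for v
      proof -
        have "{w \<in> K. adj v w} = K - {v}" using that K_clique irr by auto
        then have "a v = k - 1" using that fin by (simp add: a_def k_def)
        moreover have "k \<ge> 1" using that fin by (auto simp: k_def card_gt_0_iff Suc_le_eq)
        ultimately show ?thesis by (simp add: of_nat_diff)
      qed
      then show ?thesis by (simp add: k_def)
    qed
    moreover have "(\<Sum>v\<in>K. real (b v)) = \<alpha>"
    proof -
      have "(\<Sum>v\<in>K. real (b v)) = (\<Sum>v\<in>K. \<Sum>w\<in>W. if adj v w then 1 else 0)"
        using fin by (simp add: b_def sum.If_cases Int_def)
      also have "\<dots> = (\<Sum>w\<in>W. \<Sum>v\<in>K. if adj v w then 1 else 0)" by (rule sum.swap)
      also have "\<dots> = (\<Sum>w\<in>W. \<Sum>v\<in>K. if adj w v then 1 else 0)"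
        using sym by (intro sum.cong refl) auto
      also have "\<dots> = \<alpha>"
        using fin by (simp add: a_def \<alpha>_def sum.If_cases Int_def)
      finally show ?thesis .
    qed
    ultimately show ?thesis by simp
  qed
  define K1 where "K1 = 3 * R - 3 * R\<^sup>2 + \<xi> ^ 3 / N + C * (\<xi> * H / N + 2 * (real k + n - 1 - H / 2))"
  have "(\<Sum>v\<in>W. 6 * A v) \<le> (\<Sum>v\<in>W. 6 * R * real (a v) + 3 * R * real (b v) - 3 * R\<^sup>2 + 3 * R + (\<xi> ^ 3 / N
      + C * (\<xi> * H / N + 2 * (real k - real (a v) + (n - 1 - real (a v) - real (b v)) - H / 2))))"
    by (intro sum_mono A_le)
  also have "\<dots> = (\<Sum>v\<in>W. (6 * R - 4 * C) * real (a v) + (3 * R - 2 * C) * real (b v)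
      + K1)"
    unfolding K1_def by (intro sum.cong refl) (simp add: algebra_simps)
  also have "\<dots> = (6 * R - 4 * C) * \<alpha> + (3 * R - 2 * C) * \<beta>
      + N * K1"
    unfolding N_eq \<alpha>_def \<beta>_def sum_distrib_left W_card[symmetric] by (simp only: sum.distrib sum_constant)
  also have "\<dots> = 6 * R * \<alpha> + 3 * R * \<beta> + N * (3 * R - 3 * R\<^sup>2) + N * (\<xi> ^ 3 / N)
      + C * (N * (\<xi> * H / N) + 2 * (N * (real k + n - 1 - H / 2) - 2 * \<alpha> - \<beta>))"
    unfolding K1_def
    by (simp only: distrib_left right_diff_distrib left_diff_distrib mult_ac)
  \<comment> \<open>Only an inequality: if every vertex lies in \<open>K\<close> then
    \<open>N = 0\<close>, and division by 0 yields 0.\<close>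
  also have "\<dots> \<le> 6 * R * \<alpha> + 3 * R * \<beta> + N * (3 * R - 3 * R\<^sup>2) + \<xi> ^ 3
      + C * (\<xi> * H + 2 * (N * (real k + n - 1 - H / 2) - 2 * \<alpha> - \<beta>))"
    using \<xi>0 H0 C0 by (intro add_mono mult_left_mono order_refl) (auto simp: N_def)
  finally have W_sum: "6 * (\<Sum>v\<in>W. A v) \<le> 6 * R * \<alpha> + 3 * R * \<beta> + N * (3 * R - 3 * R\<^sup>2) + \<xi> ^ 3
      + C * (\<xi> * H + 2 * (N * (real k + n - 1 - H / 2) - 2 * \<alpha> - \<beta>))"
    by (simp add: sum_distrib_left)
  have "6 * real t \<le> real k ^ 3 + (6 * R * \<alpha> + 3 * R * \<beta> + N * (3 * R - 3 * R\<^sup>2) + \<xi> ^ 3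
      + C * (\<xi> * H + 2 * (N * (real k + n - 1 - H / 2) - 2 * \<alpha> - \<beta>)))"
    using t_le K_sum W_sum by linarith
  \<comment> \<open>Once \<open>\<alpha>\<close> and \<open>\<beta>\<close> are combined to
    \<open>S\<close>, all occurrences of \<open>k\<close> cancel, and the bound depends only on
    \<open>n\<close>, \<open>R\<close> and \<open>S\<close>.\<close>
  also have "\<dots> = R ^ 3 + 3 * R * S - 3 * R\<^sup>2 * n + C * (2 * n\<^sup>2 - 2 * S - H\<^sup>2) + (3 * R * n - 2 * C * n)"
    unfolding S_eq N_eq \<xi>_def H_def
    by (simp add: power2_eq_square power3_eq_cube algebra_simps add_divide_distrib diff_divide_distrib)
  also have "\<dots> \<le> R ^ 3 + 3 * R * S - 3 * R\<^sup>2 * n + C * (2 * n\<^sup>2 - 2 * S - H\<^sup>2) + 6 * n\<^sup>2"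
  proof -
    have "R * n \<le> n * n" using Rn by (intro mult_right_mono) auto
    moreover have "0 \<le> C * n" "0 \<le> n * n" using C0 by auto
    ultimately have "3 * (R * n) - 2 * (C * n) \<le> 6 * (n * n)" by linarith
    then show ?thesis by (simp add: power2_eq_square mult.assoc)
  qed
  \<comment> \<open>As \<open>2 * n^2 - H^2\<close> equals the denominator, \<open>C\<close> is
    exactly the value for which the terms without \<open>S\<close> cancel.\<close>
  also have "R ^ 3 + 3 * R * S - 3 * R\<^sup>2 * n + C * (2 * n\<^sup>2 - 2 * S - H\<^sup>2)
      = R * S * (3 * n\<^sup>2 - R\<^sup>2) / (n\<^sup>2 + 2 * R * n - R\<^sup>2)"
  proof -
    have D: "H\<^sup>2 + 4 * R * H + 2 * R\<^sup>2 = n\<^sup>2 + 2 * R * n - R\<^sup>2"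
      by (simp add: H_def power2_eq_square algebra_simps)
    have Dpos: "n\<^sup>2 + 2 * R * n - R\<^sup>2 > 0" using density_mult_denom[of R H] H0 RH D by simp
    have C_eq: "C * (n\<^sup>2 + 2 * R * n - R\<^sup>2) = R\<^sup>2 * (3 * n - R)"
    proof -
      have "C * (n\<^sup>2 + 2 * R * n - R\<^sup>2) = R\<^sup>2 * (3 * H + 2 * R)"
        using density_mult_eq[OF _ H0 RH] unfolding D C_def by simp
      then show ?thesis by (simp add: H_def)
    qed
    have "(R ^ 3 + 3 * R * S - 3 * R\<^sup>2 * n + C * (2 * n\<^sup>2 - 2 * S - H\<^sup>2)) * (n\<^sup>2 + 2 * R * n - R\<^sup>2)
        = (R ^ 3 + 3 * R * S - 3 * R\<^sup>2 * n) * (n\<^sup>2 + 2 * R * n - R\<^sup>2)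
          + (2 * n\<^sup>2 - 2 * S - H\<^sup>2) * (C * (n\<^sup>2 + 2 * R * n - R\<^sup>2))"
      by (simp add: algebra_simps)
    also have "\<dots> = R * S * (3 * n\<^sup>2 - R\<^sup>2)"
      unfolding C_eq H_def by (simp add: power2_eq_square power3_eq_cube algebra_simps)
    finally show ?thesis using Dpos by (simp add: eq_divide_eq)
  qed
  finally show ?thesis by (simp add: S_def)
qed

section \<open>Two lower bounds for the number of triangles\<close>

definition adj_ind :: "'a \<Rightarrow> 'a \<Rightarrow> real" where
  "adj_ind u v = (if adj u v then 1 else 0)"

text \<open>Each triangle is counted in all six orders of its vertices. Grouping by the pair
  \<open>u\<close>, \<open>w\<close> complements the codegree sum over non-adjacent pairs.\<close>

definition tri_count :: real where
  "tri_count = (\<Sum>u\<in>V. \<Sum>w\<in>V. adj_ind u w * (\<Sum>v\<in>V. adj_ind u v * adj_ind w v))"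

lemma adj_ind_sym: "adj_ind u v = adj_ind v u"
  using sym by (auto simp: adj_ind_def)

lemma deg_adj_ind: "deg v = (\<Sum>u\<in>V. adj_ind u v)" "deg v = (\<Sum>u\<in>V. adj_ind v u)"
proof -
  show *: "deg v = (\<Sum>u\<in>V. adj_ind v u)"
    using finV by (simp add: deg_def adj_ind_def sum.If_cases Int_def)
  show "deg v = (\<Sum>u\<in>V. adj_ind u v)" unfolding * by (simp add: adj_ind_sym)
qed

text \<open>Off the diagonal \<open>codeg_le\<close> bounds each codegree; the \<open>n\<close>
  pairs with \<open>u = w\<close> account for the term \<open>n^2\<close>.\<close>

lemma sum_codeg_nonadj_le:
  "(\<Sum>u\<in>V. \<Sum>w\<in>V. (1 - adj_ind u w) * (\<Sum>v\<in>V. adj_ind u v * adj_ind w v)) \<le> R * (n\<^sup>2 - (\<Sum>v\<in>V. deg v)) + n\<^sup>2"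
proof -
  have "(\<Sum>u\<in>V. \<Sum>w\<in>V. (1 - adj_ind u w) * (\<Sum>v\<in>V. adj_ind u v * adj_ind w v))
      \<le> (\<Sum>u\<in>V. \<Sum>w\<in>V. R * (1 - adj_ind u w) + (if u = w then n else 0))"
  proof (intro sum_mono)
    fix u w assume uw: "u \<in> V" "w \<in> V"
    have card: "(\<Sum>v\<in>V. adj_ind u v * adj_ind w v) = real (card {v \<in> V. adj u v \<and> adj w v})"
    proof -
      have "(\<Sum>v\<in>V. adj_ind u v * adj_ind w v) = (\<Sum>v\<in>V. if adj u v \<and> adj w v then 1 else 0)"
        by (intro sum.cong refl) (auto simp: adj_ind_def)
      then show ?thesis using finV by (simp add: sum.If_cases Int_def)
    qed
    have "real (card {v \<in> V. adj u v \<and> adj w v}) \<le> n"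
      using finV by (simp add: card_mono)
    then show "(1 - adj_ind u w) * (\<Sum>v\<in>V. adj_ind u v * adj_ind w v) \<le> R * (1 - adj_ind u w) + (if u = w then n else 0)"
      unfolding card using codeg_le[OF uw] by (auto simp: adj_ind_def)
  qed
  also have "\<dots> = R * (n\<^sup>2 - (\<Sum>u\<in>V. deg u)) + n\<^sup>2"
    using finV by (simp add: sum.distrib sum_subtractf deg_adj_ind(2) power2_eq_square flip: sum_distrib_left)
  finally show ?thesis .
qed

text \<open>The sum of the squared degrees counts walks \<open>u - v - w\<close>. Those with
  adjacent ends give \<open>tri_count\<close>, the others are bounded by
  \<open>sum_codeg_nonadj_le\<close>, and Cauchy-Schwarz brings in the square of the degree
  sum.\<close>

lemma tri_count_lower_convexity:
  "(\<Sum>v\<in>V. deg v)\<^sup>2 \<le> n * (tri_count + R * (n\<^sup>2 - (\<Sum>v\<in>V. deg v)) + n\<^sup>2)"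
proof -
  have "(\<Sum>v\<in>V. (deg v)\<^sup>2) = (\<Sum>v\<in>V. \<Sum>u\<in>V. \<Sum>w\<in>V. adj_ind u v * adj_ind w v)"
    by (simp add: power2_eq_square deg_adj_ind(1) sum_product)
  also have "\<dots> = (\<Sum>u\<in>V. \<Sum>v\<in>V. \<Sum>w\<in>V. adj_ind u v * adj_ind w v)"
    by (rule sum.swap)
  also have "\<dots> = (\<Sum>u\<in>V. \<Sum>w\<in>V. \<Sum>v\<in>V. adj_ind u v * adj_ind w v)"
    by (intro sum.cong refl sum.swap)
  also have "\<dots> = tri_count + (\<Sum>u\<in>V. \<Sum>w\<in>V. (1 - adj_ind u w) * (\<Sum>v\<in>V. adj_ind u v * adj_ind w v))"
    unfolding tri_count_def by (simp add: algebra_simps flip: sum.distrib)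
  also have "\<dots> \<le> tri_count + R * (n\<^sup>2 - (\<Sum>v\<in>V. deg v)) + n\<^sup>2"
    using sum_codeg_nonadj_le by simp
  finally have "n * (\<Sum>v\<in>V. (deg v)\<^sup>2) \<le> n * (tri_count + R * (n\<^sup>2 - (\<Sum>v\<in>V. deg v)) + n\<^sup>2)"
    by (intro mult_left_mono) auto
  moreover have "(\<Sum>v\<in>V. 1 * deg v)\<^sup>2 \<le> (\<Sum>v\<in>V. 1\<^sup>2) * (\<Sum>v\<in>V. (deg v)\<^sup>2)"
    by (rule Cauchy_Schwarz_ineq_sum)
  ultimately show ?thesis by simp
qed

text \<open>A triple that is not a triangle lacks at least two of its three edges, or lacks one and
  is a path with non-adjacent ends. In both cases missing edges plus such paths number at least two.
  Summed over all triples, the paths contribute \<open>3 * Q\<close>.\<close>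

lemma tri_count_lower_linear:
  "n ^ 3 - 3 / 2 * n * (n\<^sup>2 - (\<Sum>v\<in>V. deg v)) - 3 / 2 * (R * (n\<^sup>2 - (\<Sum>v\<in>V. deg v)) + n\<^sup>2) \<le> tri_count"
proof -
  define Q where "Q = (\<Sum>u\<in>V. \<Sum>w\<in>V. (1 - adj_ind u w) * (\<Sum>v\<in>V. adj_ind u v * adj_ind w v))"
  let ?S = "\<Sum>v\<in>V. deg v"
  have sum_1: "(\<Sum>u\<in>V. \<Sum>w\<in>V. 1 - adj_ind u w) = n\<^sup>2 - ?S"
    by (simp add: sum_subtractf deg_adj_ind(2) power2_eq_square)
  have e1: "(\<Sum>u\<in>V. \<Sum>w\<in>V. \<Sum>v\<in>V. 1 - adj_ind u w) = n * (n\<^sup>2 - ?S)"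
    unfolding sum_1[symmetric] by (simp add: sum_distrib_left)
  have e2: "(\<Sum>u\<in>V. \<Sum>w\<in>V. \<Sum>v\<in>V. 1 - adj_ind u v) = n * (n\<^sup>2 - ?S)"
    unfolding sum_1[symmetric] by (simp add: sum_distrib_left)
  have e3: "(\<Sum>u\<in>V. \<Sum>w\<in>V. \<Sum>v\<in>V. 1 - adj_ind w v) = n * (n\<^sup>2 - ?S)"
    unfolding sum_1[symmetric] by simp
  have q1: "(\<Sum>u\<in>V. \<Sum>w\<in>V. \<Sum>v\<in>V. (1 - adj_ind u w) * (adj_ind u v * adj_ind w v)) = Q"
    by (simp add: Q_def sum_distrib_left)
  have q2: "(\<Sum>u\<in>V. \<Sum>w\<in>V. \<Sum>v\<in>V. (1 - adj_ind u v) * (adj_ind u w * adj_ind w v)) = Q"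
  proof -
    have "(\<Sum>u\<in>V. \<Sum>w\<in>V. \<Sum>v\<in>V. (1 - adj_ind u v) * (adj_ind u w * adj_ind w v))
        = (\<Sum>u\<in>V. \<Sum>v\<in>V. \<Sum>w\<in>V. (1 - adj_ind u v) * (adj_ind u w * adj_ind w v))"
      by (intro sum.cong refl sum.swap)
    also have "\<dots> = Q"
      unfolding Q_def sum_distrib_left by (intro sum.cong refl) (metis adj_ind_sym)
    finally show ?thesis .
  qed
  have q3: "(\<Sum>u\<in>V. \<Sum>w\<in>V. \<Sum>v\<in>V. (1 - adj_ind w v) * (adj_ind u w * adj_ind u v)) = Q"
  proof -
    have "(\<Sum>u\<in>V. \<Sum>w\<in>V. \<Sum>v\<in>V. (1 - adj_ind w v) * (adj_ind u w * adj_ind u v))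
        = (\<Sum>w\<in>V. \<Sum>u\<in>V. \<Sum>v\<in>V. (1 - adj_ind w v) * (adj_ind u w * adj_ind u v))"
      by (rule sum.swap)
    also have "\<dots> = (\<Sum>w\<in>V. \<Sum>v\<in>V. \<Sum>u\<in>V. (1 - adj_ind w v) * (adj_ind u w * adj_ind u v))"
      by (intro sum.cong refl sum.swap)
    also have "\<dots> = Q"
      unfolding Q_def sum_distrib_left by (intro sum.cong refl) (metis adj_ind_sym)
    finally show ?thesis .
  qed
  have "(\<Sum>u\<in>V. \<Sum>w\<in>V. \<Sum>v\<in>V. 2 - 2 * (adj_ind u w * (adj_ind u v * adj_ind w v)))
      \<le> (\<Sum>u\<in>V. \<Sum>w\<in>V. \<Sum>v\<in>V. ((1 - adj_ind u w) + (1 - adj_ind u v) + (1 - adj_ind w v))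
        + ((1 - adj_ind u w) * (adj_ind u v * adj_ind w v) + (1 - adj_ind u v) * (adj_ind u w * adj_ind w v)
        + (1 - adj_ind w v) * (adj_ind u w * adj_ind u v)))"
    by (intro sum_mono) (simp add: adj_ind_def)
  also have "\<dots> = 3 * (n * (n\<^sup>2 - ?S)) + 3 * Q"
    by (simp only: sum.distrib e1 e2 e3 q1 q2 q3)
  also have "(\<Sum>u\<in>V. \<Sum>w\<in>V. \<Sum>v\<in>V. 2 - 2 * (adj_ind u w * (adj_ind u v * adj_ind w v))) = 2 * n ^ 3 - 2 * tri_count"
    unfolding tri_count_def by (simp add: sum_subtractf sum_distrib_left power3_eq_cube)
  finally show ?thesis
    using sum_codeg_nonadj_le unfolding Q_def by argo
qed

lemma tri_count_le:
  "tri_count \<le> 6 * real (card {\<tau>. \<tau> \<subseteq> V \<and> card \<tau> = 3 \<and> (\<forall>u\<in>\<tau>. \<forall>v\<in>\<tau>. u \<noteq> v \<longrightarrow> adj u v)})"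
proof -
  let ?T = "{\<tau>. \<tau> \<subseteq> V \<and> card \<tau> = 3 \<and> (\<forall>u\<in>\<tau>. \<forall>v\<in>\<tau>. u \<noteq> v \<longrightarrow> adj u v)}"
  define O3 where "O3 = {(u, w, v) \<in> V \<times> V \<times> V. adj u w \<and> adj u v \<and> adj w v}"
  define F where "F \<tau> = {(u, w, v). {u, w, v} = \<tau> \<and> u \<noteq> w \<and> u \<noteq> v \<and> w \<noteq> v}" for \<tau> :: "'a set"
  have "tri_count = (\<Sum>u\<in>V. \<Sum>w\<in>V. \<Sum>v\<in>V. if adj u w \<and> adj u v \<and> adj w v then 1 else 0)"
    unfolding tri_count_def sum_distrib_left by (intro sum.cong refl) (auto simp: adj_ind_def)
  also have "\<dots> = (\<Sum>x\<in>V \<times> V \<times> V. if x \<in> O3 then 1 else 0)"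
    unfolding sum.cartesian_product by (intro sum.cong refl) (auto simp: O3_def split: if_splits)
  also have "\<dots> = real (card O3)"
  proof -
    have "V \<times> V \<times> V \<inter> O3 = O3" by (auto simp: O3_def)
    then show ?thesis using finV by (simp add: sum.If_cases)
  qed
  finally have eq: "tri_count = real (card O3)" .
  have finT: "finite ?T" using finV by simp
  have F6: "finite (F \<tau>) \<and> card (F \<tau>) \<le> 6" if "\<tau> \<in> ?T" for \<tau>
  proof -
    have "card \<tau> = 3" using that by simp
    then obtain x y z where xyz: "\<tau> = {x, y, z}" unfolding card_3_iff by blast
    let ?L = "[(x, y, z), (x, z, y), (y, x, z), (y, z, x), (z, x, y), (z, y, x)]"
    have sub: "F \<tau> \<subseteq> set ?L"
    proof
      fix q assume "q \<in> F \<tau>"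
      then obtain u w v where q: "q = (u, w, v)" and eq: "{u, w, v} = {x, y, z}"
        and d: "u \<noteq> w" "u \<noteq> v" "w \<noteq> v"
        unfolding F_def xyz by blast
      have "u \<in> {x, y, z}" "w \<in> {x, y, z}" "v \<in> {x, y, z}" unfolding eq[symmetric] by auto
      then show "q \<in> set ?L"
        unfolding q using d by auto
    qed
    have "finite (F \<tau>)" using sub by (rule finite_subset) simp
    moreover have "card (F \<tau>) \<le> card (set ?L)" using sub by (intro card_mono) auto
    moreover have "card (set ?L) \<le> length ?L" by (rule card_length)
    ultimately show ?thesis by simp
  qed
  have "O3 \<subseteq> (\<Union>\<tau>\<in>?T. F \<tau>)"
  proof
    fix x assume "x \<in> O3"
    then obtain u w v where x: "x = (u, w, v)" "u \<in> V" "w \<in> V" "v \<in> V" "adj u w" "adj u v" "adj w v"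
      by (auto simp: O3_def)
    then have d: "u \<noteq> w" "u \<noteq> v" "w \<noteq> v" using irr by auto
    then have "{u, w, v} \<in> ?T" using x sym by auto
    moreover have "x \<in> F {u, w, v}" using x(1) d by (simp add: F_def)
    ultimately show "x \<in> (\<Union>\<tau>\<in>?T. F \<tau>)" by blast
  qed
  then have "card O3 \<le> card (\<Union>\<tau>\<in>?T. F \<tau>)"
    using finT F6 by (intro card_mono) auto
  also have "\<dots> \<le> (\<Sum>\<tau>\<in>?T. card (F \<tau>))" using finT by (rule card_UN_le)
  also have "\<dots> \<le> (\<Sum>\<tau>\<in>?T. 6)" using F6 by (intro sum_mono) auto
  finally have "card O3 \<le> 6 * card ?T" by simp
  then have "real (card O3) \<le> real (6 * card ?T)" by (simp only: of_nat_le_iff)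
  then show ?thesis unfolding eq by (simp only: of_nat_mult of_nat_numeral)
qed

end

section \<open>Bounds for beta\<close>

text \<open>The function \<open>c(\<kappa>)\<close> of the introduction.\<close>

definition tri_ratio :: "real \<Rightarrow> real" where
  "tri_ratio \<kappa> = (3 - \<kappa>^2) * \<kappa> / (1 + 2 * \<kappa> - \<kappa>^2)"

lemma tri_ratio_denom_pos:
  assumes "0 \<le> \<kappa>" "\<kappa> \<le> (1::real)" shows "1 + 2 * \<kappa> - \<kappa>^2 > 0"
proof -
  have "\<kappa>^2 \<le> \<kappa>" using assms by (simp add: power2_eq_square mult_left_le)
  then show ?thesis using assms by linarith
qed

lemma beta_admissible_iff:
  "beta_admissible \<epsilon> \<kappa> \<longleftrightarrow> 0 \<le> \<kappa> \<and> \<kappa> \<le> 1 \<and>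
     \<epsilon>^2 - \<kappa> * (1 - \<epsilon>) \<le> tri_ratio \<kappa> * \<epsilon> \<and>
     1 - 3 / 2 * (1 + \<kappa>) * (1 - \<epsilon>) \<le> tri_ratio \<kappa> * \<epsilon>"
  by (simp add: beta_admissible_def tri_ratio_def)

text \<open>After cross-multiplication the difference factors as \<open>b - a\<close> times a
  polynomial in \<open>b - a\<close>, \<open>a + b\<close> and \<open>P = a * b\<close>. That
  polynomial is at least \<open>2 - 2 * P^2\<close>, because \<open>a + b \<le> 1 + P\<close> and
  \<open>(b - a)^2 \<le> (1 - P)^2\<close>.\<close>

lemma tri_ratio_mono:
  assumes "0 \<le> a" "a \<le> b" "b \<le> 1" shows "tri_ratio a \<le> tri_ratio b"
proof -
  define P where "P = a * b"
  have ab: "0 \<le> b" "a \<le> 1" using assms by auto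
  have P: "0 \<le> P" "P \<le> 1" using assms ab by (auto simp: P_def mult_le_one)
  have "0 \<le> (1 - a) * (1 - b)" using assms ab by simp
  then have s: "a + b \<le> 1 + P" by (simp add: P_def algebra_simps)
  have "(a + b)\<^sup>2 \<le> (1 + P)\<^sup>2" using s assms ab by (intro power_mono) auto
  then have d: "(b - a)\<^sup>2 \<le> (1 - P)\<^sup>2" by (simp add: P_def power2_eq_square algebra_simps)
  have "2 * P * (a + b) \<le> 2 * P * (1 + P)" using s P by (intro mult_left_mono) auto
  moreover have "P * P \<le> 1" using P by (simp add: mult_le_one)
  ultimately have "0 \<le> 3 - (b - a)\<^sup>2 - 2 * P * (a + b) + P\<^sup>2"
    using d by (simp add: power2_eq_square algebra_simps)
  then have "0 \<le> (b - a) * (3 - (b - a)\<^sup>2 - 2 * P * (a + b) + P\<^sup>2)"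
    using assms by simp
  also have "\<dots> = (3 - b\<^sup>2) * b * (1 + 2 * a - a\<^sup>2) - (3 - a\<^sup>2) * a * (1 + 2 * b - b\<^sup>2)"
    by (simp add: P_def power2_eq_square algebra_simps)
  finally show ?thesis
    unfolding tri_ratio_def using tri_ratio_denom_pos[of a] tri_ratio_denom_pos[of b] assms ab
    by (simp add: divide_simps)
qed

text \<open>The first condition alone excludes every \<open>\<kappa> \<le> p^2\<close>: its left
  side decreases in \<kappa>, its right side increases, and at \<open>p^2\<close> it fails, the
  difference after clearing the denominator being a positive multiple of
  \<open>p^2 * (1 - p)^2\<close>.\<close>

lemma beta_gt:
  assumes "0 < \<epsilon>" "\<epsilon> < 1" shows "(1 - sqrt (1 - \<epsilon>))^2 < beta \<epsilon>"
proof (rule ccontr)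
  define p where "p = 1 - sqrt (1 - \<epsilon>)"
  have p: "0 < p" "p < 1" using assms by (auto simp: p_def)
  have "(1 - p)^2 = 1 - \<epsilon>" using assms by (simp add: p_def)
  then have \<epsilon>: "\<epsilon> = 2 * p - p^2" by (simp add: power2_eq_square algebra_simps)
  assume "\<not> ?thesis"
  then have le: "beta \<epsilon> \<le> p^2" by (simp add: p_def)
  have p2: "0 \<le> p^2" "p^2 \<le> 1" using p by (auto simp: power_le_one)
  have adm: "beta_admissible \<epsilon> (beta \<epsilon>)" by (rule beta_least(1)[OF assms])
  have "\<epsilon>^2 - p^2 * (1 - \<epsilon>) \<le> \<epsilon>^2 - beta \<epsilon> * (1 - \<epsilon>)"
    using le assms by (simp add: mult_right_mono)
  also have "\<dots> \<le> tri_ratio (beta \<epsilon>) * \<epsilon>" using adm by (simp add: beta_admissible_iff)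
  also have "\<dots> \<le> tri_ratio (p^2) * \<epsilon>"
    using adm le p2 assms by (intro mult_right_mono tri_ratio_mono) (auto simp: beta_admissible_iff)
  finally have "\<epsilon>^2 - p^2 * (1 - \<epsilon>) \<le> tri_ratio (p^2) * \<epsilon>" .
  moreover have "tri_ratio (p^2) * \<epsilon> < \<epsilon>^2 - p^2 * (1 - \<epsilon>)"
  proof -
    have "0 < 3 - 2 * p + 2 * p^2 + 2 * p^3 - p^4"
    proof -
      have "p^4 \<le> p^3" "0 < p^3" using p by (auto simp: power_decreasing)
      moreover have "0 < p^2" using p by simp
      ultimately show ?thesis using p by linarith
    qed
    then have "0 < p^2 * ((1 - p)^2 * (3 - 2 * p + 2 * p^2 + 2 * p^3 - p^4))"
      using p by simp
    also have "\<dots> = (\<epsilon>^2 - p^2 * (1 - \<epsilon>)) * (1 + 2 * p^2 - (p^2)^2) - (3 - (p^2)^2) * p^2 * \<epsilon>"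
      unfolding \<epsilon> by (simp add: power2_eq_square power3_eq_cube power4_eq_xxxx algebra_simps)
    finally show ?thesis
      unfolding tri_ratio_def using tri_ratio_denom_pos[OF p2] by (simp add: pos_divide_less_eq)
  qed
  ultimately show False by simp
qed

text \<open>At \<open>\<kappa> = 1 - s\<close> both conditions hold strictly, so by continuity they
  still hold slightly to the left of this point.\<close>

lemma beta_less:
  assumes "0 < \<epsilon>" "\<epsilon> < 1" shows "beta \<epsilon> < 1 - sqrt (1 - \<epsilon>)"
proof -
  define s where "s = sqrt (1 - \<epsilon>)"
  have s: "0 < s" "s < 1" using assms by (auto simp: s_def)
  have "s^2 = 1 - \<epsilon>" using assms by (simp add: s_def)
  then have \<epsilon>: "\<epsilon> = 1 - s^2" by simp
  let ?k = "1 - s"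
  have denom: "1 + 2 * ?k - ?k^2 > 0" using s by (intro tri_ratio_denom_pos) auto
  have ss: "s^4 < s^2" "s^5 < s^3" "s^3 < s^2" "0 < s^5"
    using s power_strict_decreasing[of 2 4 s] power_strict_decreasing[of 3 5 s] power_strict_decreasing[of 2 3 s]
    by auto
  have 1: "\<epsilon>^2 - ?k * (1 - \<epsilon>) < tri_ratio ?k * \<epsilon>"
  proof -
    have "0 < s^2" using s by simp
    then have "0 < 2 * s^2 + s^3 - s^4 - s^5" using ss by linarith
    then have "0 < (1 - s) * (2 * s^2 + s^3 - s^4 - s^5)" using s by simp
    also have "\<dots> = (3 - ?k^2) * ?k * \<epsilon> - (\<epsilon>^2 - ?k * (1 - \<epsilon>)) * (1 + 2 * ?k - ?k^2)"
      unfolding \<epsilon> by (simp add: power2_eq_square power3_eq_cube numeral_eq_Suc algebra_simps)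
    finally show ?thesis unfolding tri_ratio_def using denom by (simp add: pos_less_divide_eq)
  qed
  have 2: "1 - 3 / 2 * (1 + ?k) * (1 - \<epsilon>) < tri_ratio ?k * \<epsilon>"
  proof -
    have "0 < 2 * s^2 - 2 * s^3 + s^5 / 2" using ss by linarith
    also have "\<dots> = (3 - ?k^2) * ?k * \<epsilon> - (1 - 3 / 2 * (1 + ?k) * (1 - \<epsilon>)) * (1 + 2 * ?k - ?k^2)"
      unfolding \<epsilon> by (simp add: power2_eq_square power3_eq_cube numeral_eq_Suc algebra_simps diff_divide_distrib add_divide_distrib)
    finally show ?thesis unfolding tri_ratio_def using denom by (simp add: pos_less_divide_eq)
  qed
  have tr: "(tri_ratio \<longlongrightarrow> tri_ratio ?k) (at_left ?k)"
    unfolding tri_ratio_def using denom by (intro tendsto_intros) auto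
  have ev: "\<forall>\<^sub>F \<kappa> in at_left ?k. 0 < tri_ratio \<kappa> * \<epsilon> - (\<epsilon>^2 - \<kappa> * (1 - \<epsilon>))"
    "\<forall>\<^sub>F \<kappa> in at_left ?k. 0 < tri_ratio \<kappa> * \<epsilon> - (1 - 3 / 2 * (1 + \<kappa>) * (1 - \<epsilon>))"
    by (rule order_tendstoD(1)[where y = "tri_ratio ?k * \<epsilon> - (\<epsilon>^2 - ?k * (1 - \<epsilon>))"],
        intro tendsto_intros tr, use 1 in simp)
       (rule order_tendstoD(1)[where y = "tri_ratio ?k * \<epsilon> - (1 - 3 / 2 * (1 + ?k) * (1 - \<epsilon>))"],
        intro tendsto_intros tr, use 2 in simp)
  have "\<forall>\<^sub>F \<kappa> in at_left ?k. \<kappa> \<in> {0<..<?k}"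
    using s by (intro eventually_at_leftI[of 0]) auto
  with ev have "\<forall>\<^sub>F \<kappa> in at_left ?k. beta_admissible \<epsilon> \<kappa> \<and> \<kappa> < ?k"
    by eventually_elim (use s in \<open>auto simp: beta_admissible_iff\<close>)
  then obtain \<kappa> where "beta_admissible \<epsilon> \<kappa>" "\<kappa> < ?k"
    using eventually_happens[of _ "at_left ?k"] by (auto simp: trivial_limit_at_left_real)
  then show ?thesis using beta_least(2)[OF assms] unfolding s_def by force
qed

section \<open>Sequences of graphs\<close>

context c4_graph
begin

text \<open>The counting inequalities are divided by \<open>n^3\<close> (the convexity bound by
  \<open>n^4\<close>). The error \<open>8 / n\<close> gathers \<open>6 / n\<close> from the upper
  bound for triangles and at most \<open>2 / n\<close> from the diagonal pairs in the codegree
  sum.\<close>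

lemma tri_ratio_bounds:
  assumes order_bound: "\<And>\<pi> :: 'a \<Rightarrow> nat. inj_on \<pi> V \<Longrightarrow>
      card {\<tau>. \<tau> \<subseteq> V \<and> card \<tau> = 3 \<and> (\<forall>u\<in>\<tau>. \<forall>v\<in>\<tau>. u \<noteq> v \<longrightarrow> adj u v)}
      \<le> (\<Sum>v\<in>V. \<Sum>s<r. card {w \<in> V. adj v w \<and> \<pi> w < \<pi> v} - Suc s)"
    and ne: "V \<noteq> {}"
  defines "\<kappa> \<equiv> R / n" and "\<epsilon> \<equiv> (\<Sum>v\<in>V. deg v) / n\<^sup>2"
  shows "\<epsilon>\<^sup>2 - \<kappa> * (1 - \<epsilon>) \<le> tri_ratio \<kappa> * \<epsilon> + 8 / n"
    "1 - 3 / 2 * (1 + \<kappa>) * (1 - \<epsilon>) \<le> tri_ratio \<kappa> * \<epsilon> + 8 / n"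
proof -
  define S where "S = (\<Sum>v\<in>V. deg v)"
  define T where "T = tri_count / n ^ 3"
  have n: "n > 0" using finV ne by (simp add: card_gt_0_iff)
  have R: "R = \<kappa> * n" and S: "S = \<epsilon> * n\<^sup>2" and T: "tri_count = T * n ^ 3"
    using n by (simp_all add: \<kappa>_def \<epsilon>_def S_def T_def)
  have \<kappa>: "0 \<le> \<kappa>" "\<kappa> \<le> 1" using r_le n by (auto simp: \<kappa>_def)
  have "tri_count \<le> R * S * (3 * n\<^sup>2 - R\<^sup>2) / (n\<^sup>2 + 2 * R * n - R\<^sup>2) + 6 * n\<^sup>2"
    using tri_count_le triangle_upper_bound[OF order_bound ne] by (simp add: S_def)
  also have "R * S * (3 * n\<^sup>2 - R\<^sup>2) / (n\<^sup>2 + 2 * R * n - R\<^sup>2) = tri_ratio \<kappa> * \<epsilon> * n ^ 3"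
  proof -
    have "R * S * (3 * n\<^sup>2 - R\<^sup>2) = n\<^sup>2 * ((3 - \<kappa>\<^sup>2) * \<kappa> * \<epsilon> * n ^ 3)"
      "n\<^sup>2 + 2 * R * n - R\<^sup>2 = n\<^sup>2 * (1 + 2 * \<kappa> - \<kappa>\<^sup>2)"
      unfolding R S by (simp_all add: power2_eq_square power3_eq_cube algebra_simps)
    then show ?thesis using n by (simp add: tri_ratio_def)
  qed
  finally have "T * n ^ 3 \<le> (tri_ratio \<kappa> * \<epsilon> + 6 / n) * n ^ 3"
    unfolding T using n by (simp add: distrib_right power2_eq_square power3_eq_cube)
  then have upper: "T \<le> tri_ratio \<kappa> * \<epsilon> + 6 / n" using n by simp
  have "S\<^sup>2 \<le> n * (tri_count + R * (n\<^sup>2 - S) + n\<^sup>2)"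
    using tri_count_lower_convexity by (simp add: S_def)
  then have "\<epsilon>\<^sup>2 * n ^ 4 \<le> (T + \<kappa> * (1 - \<epsilon>) + 1 / n) * n ^ 4"
    unfolding T R S using n by (simp add: algebra_simps power2_eq_square power3_eq_cube power4_eq_xxxx)
  then have "\<epsilon>\<^sup>2 \<le> T + \<kappa> * (1 - \<epsilon>) + 1 / n" using n by simp
  moreover have "1 / n \<le> 2 / n" "6 / n + 2 / n = 8 / n" using n by (auto simp: divide_right_mono)
  ultimately show "\<epsilon>\<^sup>2 - \<kappa> * (1 - \<epsilon>) \<le> tri_ratio \<kappa> * \<epsilon> + 8 / n"
    using upper by linarith
  have "n ^ 3 - 3 / 2 * n * (n\<^sup>2 - S) - 3 / 2 * (R * (n\<^sup>2 - S) + n\<^sup>2) \<le> tri_count"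
    using tri_count_lower_linear by (simp add: S_def)
  then have "(1 - 3 / 2 * (1 + \<kappa>) * (1 - \<epsilon>) - (3 / 2) / n) * n ^ 3 \<le> T * n ^ 3"
    unfolding T R S using n by (simp add: algebra_simps power2_eq_square power3_eq_cube diff_divide_distrib add_divide_distrib)
  then have "1 - 3 / 2 * (1 + \<kappa>) * (1 - \<epsilon>) - (3 / 2) / n \<le> T" using n by simp
  moreover have "(3 / 2) / n \<le> 2 / n" "6 / n + 2 / n = 8 / n" using n by (auto simp: divide_simps)
  ultimately show "1 - 3 / 2 * (1 + \<kappa>) * (1 - \<epsilon>) \<le> tri_ratio \<kappa> * \<epsilon> + 8 / n"
    using upper by linarith
qed

end

section \<open>Transfer to simple graphs\<close>

lemma clique_number_props:
  assumes "simple_graph G"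
  shows "clique_number G \<le> card (verts G)"
    and "K \<subseteq> verts G \<Longrightarrow> clique K (edges G) \<Longrightarrow> card K \<le> clique_number G"
proof -
  let ?S = "{card K |K. K \<subseteq> verts G \<and> clique K (edges G)}"
  have fin: "finite (verts G)" using assms by (simp add: simple_graph_def)
  then have sub: "?S \<subseteq> {..card (verts G)}" by (auto intro: card_mono)
  then have finS: "finite ?S" by (rule finite_subset) simp
  have "card {} \<in> ?S" by (auto simp: clique_def intro!: exI[of _ "{}"])
  then have "Max ?S \<in> ?S" using finS by (intro Max_in) auto
  then show "clique_number G \<le> card (verts G)" using sub unfolding clique_number_def by blast
  show "card K \<le> clique_number G" if "K \<subseteq> verts G" "clique K (edges G)"
    unfolding clique_number_def using that by (intro Max_ge[OF finS]) auto
qed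

lemma C4_free_adj:
  assumes "simple_graph G" "C4_free G"
    and V: "u \<in> verts G" "v \<in> verts G" "w \<in> verts G" "w' \<in> verts G"
    and uv: "u \<noteq> v" "{u, v} \<notin> edges G" and ww: "w \<noteq> w'"
    and e: "{u, w} \<in> edges G" "{v, w} \<in> edges G" "{u, w'} \<in> edges G" "{v, w'} \<in> edges G"
  shows "{w, w'} \<in> edges G"
proof (rule ccontr)
  assume ne: "{w, w'} \<notin> edges G"
  have no_loop: "{x} \<notin> edges G" for x
    using assms(1) by (auto simp: simple_graph_def nsets_def)
  then have d: "u \<noteq> w" "v \<noteq> w" "u \<noteq> w'" "v \<noteq> w'" using e by (auto simp: insert_absorb)
  let ?W = "{u, w, v, w'}"
  \<comment> \<open>The cyclic order is \<open>u, w, v, w'\<close>; the missing chords are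
    \<open>{u, v}\<close> and \<open>{w, w'}\<close>.\<close>
  let ?f = "\<lambda>x. if x = u then 0 else if x = w then 1 else if x = v then 2 else (3::nat)"
  have C: "cycle_graph 4 = ({0, 1, 2, 3}, {{0, 1}, {1, 2}, {2, 3}, {3, 0}})"
  proof -
    have four: "{..<4} = {0, 1, 2, 3 :: nat}" by (auto simp: numeral_eq_Suc lessThan_Suc)
    have "{{i, (i + 1) mod 4} |i. i < 4} = (\<lambda>i. {i, (i + 1) mod 4}) ` {..<4 :: nat}" by auto
    moreover have "(0 + 1) mod 4 = (1 :: nat)" "(1 + 1) mod 4 = (2 :: nat)"
      "(2 + 1) mod 4 = (3 :: nat)" "(3 + 1) mod 4 = (0 :: nat)" by simp_all
    ultimately show ?thesis
      unfolding cycle_graph_def four by (simp only: image_insert image_empty)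
  qed
  have "graph_isomorphic (induced_subgraph G ?W) (cycle_graph 4)"
    unfolding graph_isomorphic_def
  proof (intro exI[of _ ?f] conjI)
    show "bij_betw ?f (verts (induced_subgraph G ?W)) (verts (cycle_graph 4))"
      unfolding C induced_subgraph_def using d uv(1) ww by (auto simp: bij_betw_def inj_on_def)
    show "\<forall>x\<in>verts (induced_subgraph G ?W). \<forall>y\<in>verts (induced_subgraph G ?W).
        ({x, y} \<in> edges (induced_subgraph G ?W)) = ({?f x, ?f y} \<in> edges (cycle_graph 4))"
      unfolding C induced_subgraph_def
      using d uv ww e ne no_loop by (auto simp: insert_commute doubleton_eq_iff)
  qed
  then show False using assms(2) V unfolding C4_free_def by auto
qed

lemma graph_tri_ratio_bounds:
  fixes G :: "'a::linorder graph"
  assumes G: "simple_graph G" "C4_free G" and ler: "leray TYPE('k::field) 2 (verts G) (clique_complex G)"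
    and ne: "verts G \<noteq> {}"
  defines "n \<equiv> real (card (verts G))"
  defines "\<kappa> \<equiv> real (clique_number G) / n" and "\<epsilon> \<equiv> 2 * real (card (edges G)) / n\<^sup>2"
  shows "\<epsilon>\<^sup>2 - \<kappa> * (1 - \<epsilon>) \<le> tri_ratio \<kappa> * \<epsilon> + 8 / n"
    "1 - 3 / 2 * (1 + \<kappa>) * (1 - \<epsilon>) \<le> tri_ratio \<kappa> * \<epsilon> + 8 / n"
proof -
  let ?V = "verts G" and ?X = "clique_complex G" and ?r = "clique_number G"
  define adj where "adj u v \<longleftrightarrow> u \<noteq> v \<and> {u, v} \<in> edges G" for u v
  have finV: "finite ?V" using G(1) by (simp add: simple_graph_def)
  have clique_adj: "clique K (edges G) \<longleftrightarrow> (\<forall>u\<in>K. \<forall>v\<in>K. u \<noteq> v \<longrightarrow> adj u v)" for K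
    by (auto simp: clique_def adj_def)
  interpret c4_graph ?V adj ?r
  proof
    show "finite ?V" by (rule finV)
    show "\<not> adj v v" for v by (simp add: adj_def)
    show "adj v w \<Longrightarrow> adj w v" for v w by (metis adj_def insert_commute)
    show "?r \<le> card ?V" by (rule clique_number_props(1)[OF G(1)])
    show "card K \<le> ?r" if "K \<subseteq> ?V" "\<And>u v. u \<in> K \<Longrightarrow> v \<in> K \<Longrightarrow> u \<noteq> v \<Longrightarrow> adj u v" for K
      using that by (intro clique_number_props(2)[OF G(1)]) (auto simp: clique_adj)
    show "adj w w'" if "u \<in> ?V" "v \<in> ?V" "u \<noteq> v" "\<not> adj u v" "w \<in> ?V" "w' \<in> ?V" "w \<noteq> w'"
      "adj u w" "adj v w" "adj u w'" "adj v w'" for u v w w'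
      using C4_free_adj[OF G, of u v w w'] that by (auto simp: adj_def)
  qed
  interpret two_leray ?V ?X "TYPE('k)"
  proof
    show "\<sigma> \<subseteq> ?V" if "\<sigma> \<in> ?X" for \<sigma> using that by (simp add: clique_complex_def)
    show "\<tau> \<in> ?X" if "\<sigma> \<in> ?X" "\<tau> \<subseteq> \<sigma>" for \<sigma> \<tau>
      using that by (auto simp: clique_complex_def clique_def)
  qed (use finV ler in auto)
  have nbrs_eq: "nbrs v = {w \<in> ?V. adj v w}" if "v \<in> ?V" for v
    unfolding nbrs_def using that by (auto simp: clique_complex_def clique_def adj_def insert_commute)
  have Tri: "{\<tau>. \<tau> \<subseteq> ?V \<and> card \<tau> = 3 \<and> (\<forall>u\<in>\<tau>. \<forall>v\<in>\<tau>. u \<noteq> v \<longrightarrow> adj u v)} = faces 2 ?X"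
    using finV by (auto simp: faces_def clique_complex_def clique_adj intro: finite_subset)
  \<comment> \<open>Lifting a 2-chain \<open>r\<close> times ends in dimension \<open>2 + r\<close>,
    where a face would be a clique on \<open>r + 3\<close> vertices.\<close>
  have no: "faces (2 + ?r) ?X = {}"
  proof (rule ccontr)
    assume "faces (2 + ?r) ?X \<noteq> {}"
    then obtain K where "K \<subseteq> ?V" "clique K (edges G)" "card K = 2 + ?r + 1"
      by (auto simp: faces_def clique_complex_def)
    then show False using clique_number_props(2)[OF G(1), of K] by simp
  qed
  have order_bound: "card {\<tau>. \<tau> \<subseteq> ?V \<and> card \<tau> = 3 \<and> (\<forall>u\<in>\<tau>. \<forall>v\<in>\<tau>. u \<noteq> v \<longrightarrow> adj u v)}
      \<le> (\<Sum>v\<in>?V. \<Sum>s<?r. card {w \<in> ?V. adj v w \<and> \<pi> w < \<pi> v} - Suc s)"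
    if "inj_on \<pi> ?V" for \<pi> :: "'a \<Rightarrow> nat"
  proof -
    have "{w \<in> nbrs v. \<pi> w < \<pi> v} = {w \<in> ?V. adj v w \<and> \<pi> w < \<pi> v}" if "v \<in> ?V" for v
      using nbrs_eq[OF that] by auto
    then show ?thesis
      unfolding Tri using card_triangles_le[OF no that] by simp
  qed
  have deg_sum: "(\<Sum>v\<in>?V. deg v) = 2 * real (card (edges G))"
  proof -
    have finE: "finite (edges G)"
      using G(1) finV by (auto simp: simple_graph_def intro: finite_subset finite_imp_finite_nsets)
    have E: "e \<subseteq> ?V" "card e = 2" if "e \<in> edges G" for e
      using G(1) that by (auto simp: simple_graph_def nsets_def)
    have "deg v = (\<Sum>e\<in>edges G. if v \<in> e then 1 else 0)" if v: "v \<in> ?V" for v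
    proof -
      have "bij_betw (\<lambda>w. {v, w}) {w \<in> ?V. adj v w} {e \<in> edges G. v \<in> e}"
        unfolding bij_betw_def
      proof
        show "inj_on (\<lambda>w. {v, w}) {w \<in> ?V. adj v w}" by (auto simp: inj_on_def doubleton_eq_iff)
        show "(\<lambda>w. {v, w}) ` {w \<in> ?V. adj v w} = {e \<in> edges G. v \<in> e}"
        proof (intro subset_antisym subsetI)
          fix e assume e: "e \<in> {e \<in> edges G. v \<in> e}"
          then obtain w where "e = {v, w}" "w \<noteq> v"
            using E[of e] by (auto simp: card_2_iff)
          then show "e \<in> (\<lambda>w. {v, w}) ` {w \<in> ?V. adj v w}"
            using e E(1)[of e] by (auto simp: adj_def)
        qed (auto simp: adj_def)
      qed
      then have "card {w \<in> ?V. adj v w} = card {e \<in> edges G. v \<in> e}" by (rule bij_betw_same_card)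
      then show ?thesis using finE by (simp add: deg_def sum.If_cases Int_def)
    qed
    then have "(\<Sum>v\<in>?V. deg v) = (\<Sum>v\<in>?V. \<Sum>e\<in>edges G. if v \<in> e then 1 else 0)" by simp
    also have "\<dots> = (\<Sum>e\<in>edges G. \<Sum>v\<in>?V. if v \<in> e then 1 else 0)" by (rule sum.swap)
    also have "\<dots> = (\<Sum>e\<in>edges G. 2)"
    proof (intro sum.cong refl)
      fix e assume e: "e \<in> edges G"
      have "?V \<inter> e = e" using E(1)[OF e] by blast
      then show "(\<Sum>v\<in>?V. if v \<in> e then 1 else 0) = (2::real)"
        using finV E(2)[OF e] by (simp add: sum.If_cases)
    qed
    finally show ?thesis by simp
  qed
  show "\<epsilon>\<^sup>2 - \<kappa> * (1 - \<epsilon>) \<le> tri_ratio \<kappa> * \<epsilon> + 8 / n"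
    "1 - 3 / 2 * (1 + \<kappa>) * (1 - \<epsilon>) \<le> tri_ratio \<kappa> * \<epsilon> + 8 / n"
    using tri_ratio_bounds[OF order_bound ne] unfolding deg_sum \<kappa>_def \<epsilon>_def n_def by simp_all
qed

text \<open>Compactness: if the ratios stayed at or below some \<open>y < beta \<epsilon>\<close>
  infinitely often, a subsequence of them would converge. In the limit the error
  \<open>8 / n\<close> disappears, so the limit is admissible and hence at least
  \<open>beta \<epsilon>\<close>.\<close>

lemma liminf_clique_ratio_ge_beta:
  fixes G :: "nat \<Rightarrow> 'a::linorder graph"
  assumes \<epsilon>: "0 < \<epsilon>" "\<epsilon> < 1"
    and G: "\<And>j. j \<ge> 1 \<Longrightarrow> simple_graph (G j) \<and> C4_free (G j) \<and>
      leray TYPE('k::field) 2 (verts (G j)) (clique_complex (G j))"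
    and inf: "filterlim (\<lambda>j. card (verts (G j))) at_top sequentially"
    and dens: "(\<lambda>j. edge_density (G j)) \<longlonglongrightarrow> \<epsilon>"
  shows "liminf (\<lambda>j. ereal (real (clique_number (G j)) / real (card (verts (G j))))) \<ge> ereal (beta \<epsilon>)"
proof -
  define n where "n j = real (card (verts (G j)))" for j
  define \<kappa> where "\<kappa> j = real (clique_number (G j)) / n j" for j
  define e where "e j = 2 * real (card (edges (G j))) / (n j)\<^sup>2" for j
  have n_inf: "filterlim n at_top sequentially"
    unfolding n_def by (rule filterlim_compose[OF filterlim_real_sequentially inf])
  have inv_n: "(\<lambda>j. c / n j) \<longlonglongrightarrow> 0" for c
    by (rule tendsto_divide_0[OF tendsto_const filterlim_at_top_imp_at_infinity[OF n_inf]])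
  have n_ev: "\<forall>\<^sub>F j in sequentially. n j \<ge> 2"
    using n_inf by (simp add: filterlim_at_top)
  have "\<forall>\<^sub>F j in sequentially. edge_density (G j) * (1 - 1 / n j) = e j"
    using n_ev
  proof eventually_elim
    case (elim j)
    \<comment> \<open>This gives the factor \<open>1 - 1 / n j\<close> between the density over
      pairs of distinct vertices and the ratio with \<open>n^2\<close>.\<close>
    have ch: "real (card (verts (G j)) choose 2) = n j * (n j - 1) / 2"
      using elim by (simp add: n_def choose_two real_of_nat_div of_nat_diff)
    then show ?case
      unfolding edge_density_def e_def ch using elim by (simp add: power2_eq_square divide_simps)
  qed
  moreover have "(\<lambda>j. edge_density (G j) * (1 - 1 / n j)) \<longlonglongrightarrow> \<epsilon> * (1 - 0)"
    by (intro tendsto_intros dens inv_n)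
  ultimately have e_lim: "e \<longlonglongrightarrow> \<epsilon>"
    using tendsto_cong by fastforce
  have \<kappa>_bounds: "0 \<le> \<kappa> j \<and> \<kappa> j \<le> 1" if "j \<ge> 1" for j
    using clique_number_props(1)[of "G j"] G[OF that]
    by (cases "card (verts (G j)) = 0") (auto simp: \<kappa>_def n_def)
  have "\<forall>\<^sub>F j in sequentially. y < ereal (\<kappa> j)" if y: "y < ereal (beta \<epsilon>)" for y
  proof (rule ccontr)
    assume "\<not> ?thesis"
    from not_eventually_sequentiallyD[OF this]
    obtain s :: "nat \<Rightarrow> nat" where s: "strict_mono s" "\<And>j. \<not> y < ereal (\<kappa> (s j))"
      by blast
    \<comment> \<open>Shifted by one because the assumptions on \<open>G j\<close> start at
      \<open>j = 1\<close>.\<close>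
    define s' where "s' j = s (Suc j)" for j
    have s': "strict_mono s'" using s(1) by (simp add: s'_def strict_mono_def)
    have s'1: "s' j \<ge> 1" for j
      using seq_suble[OF s(1), of "Suc j"] by (simp add: s'_def)
    have "\<forall>j. (\<kappa> \<circ> s') j \<in> {0..1}" using \<kappa>_bounds[OF s'1] by auto
    then obtain k q where k: "k \<in> {0..1}" and q: "strict_mono q" and lim: "(\<kappa> \<circ> s' \<circ> q) \<longlonglongrightarrow> k"
      using compact_imp_seq_compact[OF compact_Icc[of "0::real" 1]] unfolding seq_compact_def by metis
    define p where "p = s' \<circ> q"
    have p: "strict_mono p" unfolding p_def using s' q by (rule strict_mono_o)
    have \<kappa>_lim: "(\<lambda>j. \<kappa> (p j)) \<longlonglongrightarrow> k" using lim by (simp add: p_def o_def)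
    have e_lim': "(\<lambda>j. e (p j)) \<longlonglongrightarrow> \<epsilon>"
      using LIMSEQ_subseq_LIMSEQ[OF e_lim p] by (simp add: o_def)
    have n_lim': "(\<lambda>j. 8 / n (p j)) \<longlonglongrightarrow> 0"
      using LIMSEQ_subseq_LIMSEQ[OF inv_n p] by (simp add: o_def)
    have n_ev': "\<forall>\<^sub>F j in sequentially. n (p j) \<ge> 2"
      using n_ev p by (rule eventually_subseq[rotated])
    have bounds: "\<forall>\<^sub>F j in sequentially.
        (e (p j))\<^sup>2 - \<kappa> (p j) * (1 - e (p j)) \<le> tri_ratio (\<kappa> (p j)) * e (p j) + 8 / n (p j) \<and>
        1 - 3 / 2 * (1 + \<kappa> (p j)) * (1 - e (p j)) \<le> tri_ratio (\<kappa> (p j)) * e (p j) + 8 / n (p j)"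
      using n_ev'
    proof eventually_elim
      case (elim j)
      then have "verts (G (p j)) \<noteq> {}" by (auto simp: n_def)
      moreover have "p j \<ge> 1" using s'1 by (simp add: p_def)
      ultimately show ?case
        using graph_tri_ratio_bounds[of "G (p j)", where 'k = 'k] G[of "p j"]
        unfolding n_def \<kappa>_def e_def by blast
    qed
    have denom: "1 + 2 * k - k\<^sup>2 \<noteq> 0" using tri_ratio_denom_pos[of k] k by auto
    have tr: "(\<lambda>j. tri_ratio (\<kappa> (p j)) * e (p j) + 8 / n (p j)) \<longlonglongrightarrow> tri_ratio k * \<epsilon> + 0"
      unfolding tri_ratio_def using denom by (intro tendsto_intros \<kappa>_lim e_lim' n_lim')
    have "\<epsilon>\<^sup>2 - k * (1 - \<epsilon>) \<le> tri_ratio k * \<epsilon> + 0"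
      by (rule tendsto_le[OF _ tr, of "\<lambda>j. (e (p j))\<^sup>2 - \<kappa> (p j) * (1 - e (p j))"])
        (use bounds in \<open>auto intro!: tendsto_intros \<kappa>_lim e_lim' elim: eventually_mono\<close>)
    moreover have "1 - 3 / 2 * (1 + k) * (1 - \<epsilon>) \<le> tri_ratio k * \<epsilon> + 0"
      by (rule tendsto_le[OF _ tr, of "\<lambda>j. 1 - 3 / 2 * (1 + \<kappa> (p j)) * (1 - e (p j))"])
        (use bounds in \<open>auto intro!: tendsto_intros \<kappa>_lim e_lim' elim: eventually_mono\<close>)
    ultimately have "beta_admissible \<epsilon> k" using k by (simp add: beta_admissible_iff)
    then have "beta \<epsilon> \<le> k" by (rule beta_least(2)[OF \<epsilon>])
    moreover have "ereal k \<le> y"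
    proof (rule tendsto_upperbound)
      show "(\<lambda>j. ereal (\<kappa> (p j))) \<longlonglongrightarrow> ereal k" using \<kappa>_lim by simp
      show "\<forall>\<^sub>F j in sequentially. ereal (\<kappa> (p j)) \<le> y"
        using s(2) by (simp add: p_def s'_def not_less)
    qed simp
    ultimately show False using y by (metis ereal_less_eq(3) not_less order_trans)
  qed
  then show ?thesis unfolding le_Liminf_iff \<kappa>_def n_def by blast
qed

theorem mainTheorem3:
  shows "(\<forall>\<epsilon>::real. 0 < \<epsilon> \<and> \<epsilon> < 1 \<longrightarrow>
      (\<forall>G :: nat \<Rightarrow> 'a::linorder graph.
         (\<forall>j\<ge>1. simple_graph (G j) \<and> C4_free (G j) \<and>
            leray TYPE('k::field) 2 (verts (G j)) (clique_complex (G j))) \<and>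
         filterlim (\<lambda>j. card (verts (G j))) at_top sequentially \<and>
         (\<lambda>j. edge_density (G j)) \<longlonglongrightarrow> \<epsilon> \<longrightarrow>
         liminf (\<lambda>j. ereal (real (clique_number (G j)) / real (card (verts (G j)))))
           \<ge> ereal (beta \<epsilon>)))
    \<and> (\<forall>\<epsilon>::real. 0 < \<epsilon> \<and> \<epsilon> < 1 \<longrightarrow>
      (1 - sqrt (1 - \<epsilon>))^2 < beta \<epsilon> \<and> beta \<epsilon> < 1 - sqrt (1 - \<epsilon>))"
proof (intro conjI allI impI)
  fix \<epsilon> :: real and G :: "nat \<Rightarrow> 'a graph"
  assume "0 < \<epsilon> \<and> \<epsilon> < 1"
    and "(\<forall>j\<ge>1. simple_graph (G j) \<and> C4_free (G j) \<and>
            leray TYPE('k) 2 (verts (G j)) (clique_complex (G j))) \<and>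
         filterlim (\<lambda>j. card (verts (G j))) at_top sequentially \<and>
         (\<lambda>j. edge_density (G j)) \<longlonglongrightarrow> \<epsilon>"
  then show "liminf (\<lambda>j. ereal (real (clique_number (G j)) / real (card (verts (G j))))) \<ge> ereal (beta \<epsilon>)"
    by (intro liminf_clique_ratio_ge_beta[where 'k = 'k]) auto
qed (use beta_gt beta_less in auto)

end
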